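(* Let $\lambda \vdash n$ and let $\Psi = \Psi_3 \circ \Psi_4 \circ \cdots \circ \Psi_n$ (so $\Psi_n$ is applied first). Then $\Psi : SYT(\lambda) \to SYT(\lambda)$ is a bijection, and for every $T \in SYT(\lambda)$ one has $\mathrm{Inv}(T) = \mathrm{maj}(\Psi(T))$.
   Context: Cells of a Ferrers diagram are indexed by (row, column) coordinates $(i,j)$, rows numbered $1,2,\dots$ from the bottom and columns $1,2,\dots$ from the left; the diagram of $\lambda=(\lambda_1\ge\cdots\ge\lambda_k)$ is $\{(i,j):1\le i\le k,\ 1\le j\le\lambda_i\}$, and cell $(i,j)$ is the unit square $[j-1,j]\times[i-1,i]$ in the plane, with lower left-hand corner the point $(j-1,i-1)$. A standard Young tableau $T\in SYT(\lambda)$ is a filling of the cells by $1,\dots,n$, increasing left to right along rows and bottom to top along columns; $c(i,j)$ denotes the content of cell $(i,j)$. $\mathrm{Des}(T)=\{i : i+1 \text{ lies in a row strictly above the row containing } i\}$ and $\mathrm{maj}(T)=\sum_{i\in\mathrm{Des}(T)} i$. Path $\pi(T,k)$ ($1\le k\le n$): start at the lower left-hand corner of the cell containing $k$. At the lower left-hand corner of a cell $(i,j)$: if $i=1$ or $j=1$, go in a straight line to the origin and stop; otherwise, if $c(i-1,j)>c(i,j-1)$ take a unit step South (to the lower left corner of $(i-1,j)$), and if $c(i-1,j)<c(i,j-1)$ take a unit step West (to the lower left corner of $(i,j-1)$); iterate. If $k$ is in cell $(r,s)$, the path is a lattice path of unit South/West steps from $(s-1,r-1)$ to $(0,0)$;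 for each $1\le i\le r-1$ it crosses the line $y=i-\tfrac12$ at a single abscissa $x_i$. A cell $(i,j)$ with content less than $k$ is said to be below $\pi(T,k)$ if $i\le r-1$ and $j-\tfrac12>x_i$ (i.e. it lies weakly southeast of the path), and above $\pi(T,k)$ otherwise (weakly northwest of the path). Two cells are on the same side if both are above or both below. Map $\Psi_k$: partition the cells with content less than $k$ into blocks of maximal length consisting of cells with consecutive contents $a,a+1,\dots,a+m$ such that the cell containing $a$ is on the same side of $\pi(T,k)$ as $(1,1)$ and the cells containing $a+1,\dots,a+m$ are all on the other side (blocks may have one cell). In each block, put $a+m$ in the cell that contained $a$ and put $a+l-1$ in the cell that contained $a+l$ for $1\le l\le m$; all other cells are unchanged. The result is $\Psi_k(T)$ ($\Psi_1,\Psi_2$ are the identity). Inversion statistic: for a cell $(i,j)\neq(1,1)$ of $T$ with content $k$, its inversion path is $\pi(T,n)$ if $k=n$ and $\pi(\Psi_{k+1}\circ\cdots\circ\Psi_n(T),k)$ if $k<n$ (the cell containing $k$ in this tableau is the same cell as in $T$). An ordered pair of cells $((i,j),(p,q))$ of $T$ is an inversion pair if $c(p,q)<c(i,j)$ and $(p,q)$ is below the inversion path of $(i,j)$. $\mathrm{Inv}(T)$ is the number of inversion pairs of $T$.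
   Formalization: The inversion path of a cell is taken as the path π(Ψ_{k+1}∘…∘Ψ_n(T),k) that starts at that cell, with k its content in that intermediate tableau; with k its content in T, as written, the cell of k can move and the identity fails, e.g. T with rows 12, 34 gives Inv 3, maj 4. *)

theory Defs
  imports Complex_Main "HOL-Library.Sublist"
begin

definition is_partition :: "nat list \<Rightarrow> nat \<Rightarrow> bool" where
  "is_partition lam n \<longleftrightarrow> sorted_wrt (\<ge>) lam \<and> 0 \<notin> set lam \<and> sum_list lam = n"

text \<open>Cells are pairs (row, column), both counted from 1, rows from the bottom.\<close>

type_synonym cell = "nat \<times> nat"

definition diagram :: "nat list \<Rightarrow> cell set" where
  "diagram lam = {(i, j). 1 \<le> i \<and> i \<le> length lam \<and> 1 \<le> j \<and> j \<le> lam ! (i - 1)}"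

text \<open>A filling is a function on all pairs.  Contents of cells are positive, and the value 0
  stands for ``not a cell of the diagram''; this makes a tableau a unique function.\<close>

type_synonym filling = "cell \<Rightarrow> nat"

definition SYT :: "nat list \<Rightarrow> filling set" where
  "SYT lam = {T.
     bij_betw T (diagram lam) {1..sum_list lam} \<and>
     (\<forall>c. c \<notin> diagram lam \<longrightarrow> T c = 0) \<and>
     (\<forall>i j j'. (i, j) \<in> diagram lam \<longrightarrow> (i, j') \<in> diagram lam \<longrightarrow> j < j' \<longrightarrow> T (i, j) < T (i, j')) \<and>
     (\<forall>i i' j. (i, j) \<in> diagram lam \<longrightarrow> (i', j) \<in> diagram lam \<longrightarrow> i < i' \<longrightarrow> T (i, j) < T (i', j))}"

definition cell_of :: "filling \<Rightarrow> nat \<Rightarrow> cell" where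
  "cell_of T k = (THE c. T c = k)"

definition Des :: "nat \<Rightarrow> filling \<Rightarrow> nat set" where
  "Des n T = {i. 1 \<le> i \<and> i < n \<and> fst (cell_of T i) < fst (cell_of T (i + 1))}"

definition maj :: "nat \<Rightarrow> filling \<Rightarrow> nat" where
  "maj n T = \<Sum> (Des n T)"

text \<open>\<open>lattice_path T x y\<close> lists the lattice points visited from the point \<open>(x, y)\<close>, the lower
  left-hand corner of the cell \<open>(y + 1, x + 1)\<close>, down to the origin.  At the corner of a cell
  \<open>(i, j)\<close> with \<open>i, j > 1\<close>, the last equation compares the contents of
  \<open>(i - 1, j)\<close> and \<open>(i, j - 1)\<close>.\<close>

fun lattice_path :: "filling \<Rightarrow> nat \<Rightarrow> nat \<Rightarrow> (nat \<times> nat) list" where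
  "lattice_path T 0 0 = [(0, 0)]"
| "lattice_path T (Suc x) 0 = (Suc x, 0) # lattice_path T x 0"
| "lattice_path T 0 (Suc y) = (0, Suc y) # lattice_path T 0 y"
| "lattice_path T (Suc x) (Suc y) = (Suc x, Suc y) #
     (if T (Suc y, Suc (Suc x)) > T (Suc (Suc y), Suc x)
      then lattice_path T (Suc x) y
      else lattice_path T x (Suc y))"

definition tpath :: "filling \<Rightarrow> nat \<Rightarrow> (nat \<times> nat) list" where
  "tpath T k = (let (r, s) = cell_of T k in lattice_path T (s - 1) (r - 1))"

text \<open>The abscissa at which a path crosses the line of height \<open>i - 1/2\<close>: that of its South step
  from height \<open>i\<close> to height \<open>i - 1\<close>.\<close>

definition crossing :: "(nat \<times> nat) list \<Rightarrow> nat \<Rightarrow> nat" where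
  "crossing p i = (THE x. sublist [(x, i), (x, i - 1)] p)"

definition below :: "filling \<Rightarrow> nat \<Rightarrow> cell \<Rightarrow> bool" where
  "below T k c \<longleftrightarrow>
     (let (r, s) = cell_of T k; (i, j) = c in
        1 \<le> i \<and> i < r \<and> real j - 1/2 > real (crossing (tpath T k) i))"

definition same_side :: "filling \<Rightarrow> nat \<Rightarrow> cell \<Rightarrow> cell \<Rightarrow> bool" where
  "same_side T k c d \<longleftrightarrow> (below T k c \<longleftrightarrow> below T k d)"

text \<open>The contents \<open>a, \<dots>, a + m\<close> form a block; the last conjunct is maximality.\<close>

definition is_block :: "filling \<Rightarrow> nat \<Rightarrow> nat \<Rightarrow> nat \<Rightarrow> bool" where
  "is_block T k a m \<longleftrightarrow>
     1 \<le> a \<and> a + m < k \<and>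
     same_side T k (cell_of T a) (1, 1) \<and>
     (\<forall>l\<in>{1..m}. \<not> same_side T k (cell_of T (a + l)) (1, 1)) \<and>
     (a + m + 1 < k \<longrightarrow> same_side T k (cell_of T (a + m + 1)) (1, 1))"

definition Psi :: "nat \<Rightarrow> filling \<Rightarrow> filling" where
  "Psi k T = (\<lambda>c.
     if 1 \<le> T c \<and> T c < k then
       (let (a, m) = (THE (a, m). is_block T k a m \<and> T c \<in> {a..a + m})
        in if T c = a then a + m else T c - 1)
     else T c)"

text \<open>\<open>Psi_comp m n\<close> is the composition of \<open>Psi m, \<dots>, Psi n\<close>, with \<open>Psi n\<close> applied first
  (the identity if \<open>n < m\<close>).\<close>

definition Psi_comp :: "nat \<Rightarrow> nat \<Rightarrow> filling \<Rightarrow> filling" where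
  "Psi_comp m n = foldr (\<circ>) (map Psi [m..<Suc n]) id"

text \<open>The inversion path of a cell \<open>c\<close> is the path that starts at \<open>c\<close> among the paths of \<open>k\<close> in
  \<open>Psi_comp (k + 1) n T\<close>, \<open>1 \<le> k \<le> n\<close>, so \<open>k\<close> is the content of \<open>c\<close> in that tableau.
  This \<open>k\<close> is unique, since later steps fix the cell containing \<open>k\<close>, but it can differ from
  \<open>T c\<close>, since the earlier steps can move \<open>k\<close>.  The condition on contents in
  \<open>inversion_pairs\<close> refers to \<open>T\<close> itself.\<close>

definition inv_index :: "nat \<Rightarrow> filling \<Rightarrow> cell \<Rightarrow> nat" where
  "inv_index n T c = (THE k. k \<in> {1..n} \<and> cell_of (Psi_comp (k + 1) n T) k = c)"

definition below_inv_path :: "nat \<Rightarrow> filling \<Rightarrow> cell \<Rightarrow> cell \<Rightarrow> bool" where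
  "below_inv_path n T c d \<longleftrightarrow>
     (let k = inv_index n T c in below (Psi_comp (k + 1) n T) k d)"

definition inversion_pairs :: "nat list \<Rightarrow> filling \<Rightarrow> (cell \<times> cell) set" where
  "inversion_pairs lam T = {(c, d). c \<in> diagram lam \<and> d \<in> diagram lam \<and> c \<noteq> (1, 1) \<and>
     T d < T c \<and> below_inv_path (sum_list lam) T c d}"

definition Inv :: "nat list \<Rightarrow> filling \<Rightarrow> nat" where
  "Inv lam T = card (inversion_pairs lam T)"

end

theory Submission
  imports Defs
begin

text \<open>The path is used only through the following local rule: if \<open>c\<close> is a cell whose right and upper
  neighbours both precede \<open>k\<close>, and the path separates \<open>c\<close> from one of them, then it separates \<open>c\<close>
  from the larger one only. Hence the smaller neighbour is on the side of \<open>c\<close> and sits in between, so no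
  block starting with \<open>c\<close> reaches the larger one, and \<open>Psi k\<close> preserves standardness.

  \<open>Psi k\<close> is injective because the image determines the side of \<open>(1, 1)\<close> (that of the cell now
  containing \<open>k - 1\<close>), and then the sides of all cells, from the largest content downwards.

  \<open>Psi k\<close> reverses exactly the pairs formed by the first cell of a block and another cell of that block.
  Such cells are incomparable and lie on different sides of the path, so one is strictly northwest
  of the other; whether such a pair can be an inversion pair is then forced by its position, whatever the
  inversion path is. If \<open>(1, 1)\<close> is above the path, then undoing \<open>Psi k\<close> loses one inversion pair for each
  cell below it, which cancels the inversion pairs of the cell of \<open>k\<close>. If \<open>(1, 1)\<close> is below the path,
  it gains one for each cell above it, which together with those of the cell of \<open>k\<close> makes \<open>k - 1\<close>;
  and this case occurs iff \<open>k - 1\<close> is a descent of the final tableau.\<close>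

section \<open>Rotation of blocks\<close>

text \<open>The contents \<open>t\<close> with \<open>p t\<close> are the first elements of the blocks, and \<open>k\<close> is an exclusive
  upper bound.\<close>

definition block_rot :: "(nat \<Rightarrow> bool) \<Rightarrow> nat \<Rightarrow> nat \<Rightarrow> nat" where
  "block_rot p k t =
     (if p t then GREATEST e. t \<le> e \<and> e < k \<and> (\<forall>v. t < v \<longrightarrow> v \<le> e \<longrightarrow> \<not> p v) else t - 1)"

lemma block_rot_start:
  assumes "p t" "t < k"
  shows "t \<le> block_rot p k t" "block_rot p k t < k"
    "\<And>v. t < v \<Longrightarrow> v \<le> block_rot p k t \<Longrightarrow> \<not> p v"
    "block_rot p k t + 1 < k \<Longrightarrow> p (block_rot p k t + 1)"
proof -
  define Q where "Q e \<longleftrightarrow> t \<le> e \<and> e < k \<and> (\<forall>v. t < v \<longrightarrow> v \<le> e \<longrightarrow> \<not> p v)" for e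
  have rot: "block_rot p k t = (GREATEST e. Q e)"
    using assms by (simp add: block_rot_def Q_def)
  have bound: "Q e \<Longrightarrow> e \<le> k" for e
    by (simp add: Q_def)
  have "Q t"
    using assms by (simp add: Q_def)
  then have "Q (GREATEST e. Q e)"
    by (rule GreatestI_nat) (rule bound)
  then have Qrot: "Q (block_rot p k t)"
    by (simp add: rot)
  then show "t \<le> block_rot p k t" "block_rot p k t < k"
    "\<And>v. t < v \<Longrightarrow> v \<le> block_rot p k t \<Longrightarrow> \<not> p v"
    by (auto simp: Q_def)
  show "p (block_rot p k t + 1)" if "block_rot p k t + 1 < k"
  proof (rule ccontr)
    assume "\<not> p (block_rot p k t + 1)"
    with Qrot that have "Q (block_rot p k t + 1)"
      by (auto simp: Q_def le_Suc_eq)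
    then have "block_rot p k t + 1 \<le> (GREATEST e. Q e)"
      by (rule Greatest_le_nat) (rule bound)
    then show False
      by (simp add: rot)
  qed
qed

lemma block_rot_inner: "\<not> p t \<Longrightarrow> block_rot p k t = t - 1"
  by (simp add: block_rot_def)

lemma block_rot_range:
  assumes "p 1" "1 \<le> t" "t < k"
  shows "1 \<le> block_rot p k t" "block_rot p k t < k"
proof -
  have "1 \<le> block_rot p k t \<and> block_rot p k t < k"
  proof (cases "p t")
    case True
    then show ?thesis
      using block_rot_start(1,2)[of p t k] assms by auto
  next
    case False
    \<comment> \<open>As 1 is a start, only elements from 2 on are decreased, so none reaches
      0.\<close>
    with assms have "t \<noteq> 1" by auto
    then show ?thesis
      using assms False by (auto simp: block_rot_inner)
  qed
  then show "1 \<le> block_rot p k t" "block_rot p k t < k" by auto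
qed

text \<open>The start \<open>t\<close> jumps to the end of its block, at or after \<open>u\<close>,
  while the inner element \<open>u\<close> drops by one.\<close>

lemma block_rot_reverses:
  assumes "t < u" "u < k" "p t" "\<And>v. t < v \<Longrightarrow> v \<le> u \<Longrightarrow> \<not> p v"
  shows "block_rot p k u < block_rot p k t"
proof -
  have "\<not> block_rot p k t < u"
    using block_rot_start[of p t k] assms by force
  moreover have "block_rot p k u = u - 1"
    using assms by (simp add: block_rot_inner)
  ultimately show ?thesis
    using assms by linarith
qed

text \<open>An inner \<open>t\<close> drops by one, and \<open>u\<close> by at most one. A start
  \<open>t\<close> stays inside its block, before the next start \<open>v\<close>, and
  \<open>u\<close> is not moved below \<open>v\<close>.\<close>

lemma block_rot_preserves:
  assumes "1 \<le> t" "t < u" "u < k" and sep: "p t \<Longrightarrow> \<exists>v. t < v \<and> v \<le> u \<and> p v"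
  shows "block_rot p k t < block_rot p k u"
proof (cases "p t")
  case False
  then show ?thesis
    using assms block_rot_start(1)[of p u k] by (cases "p u") (auto simp: block_rot_inner)
next
  case True
  then obtain v where v: "t < v" "v \<le> u" "p v"
    using sep by auto
  have "\<not> v \<le> block_rot p k t"
    using block_rot_start(3)[of p t k v] True v assms by auto
  then have less: "block_rot p k t < v" by simp
  show ?thesis
  proof (cases "p u")
    case True
    then show ?thesis
      using less v block_rot_start(1)[of p u k] assms by linarith
  next
    case False
    then have "v \<noteq> u" using v by auto
    with less v False show ?thesis
      by (auto simp: block_rot_inner)
  qed
qed

lemma block_rot_less_iff:
  assumes "1 \<le> t" "t < u" "u < k"
  shows "block_rot p k u < block_rot p k t \<longleftrightarrow> p t \<and> (\<forall>v. t < v \<longrightarrow> v \<le> u \<longrightarrow> \<not> p v)"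
  using block_rot_reverses[of t u k p] block_rot_preserves[of t u k p] assms
  by (metis less_asym)

lemma inj_on_block_rot: "inj_on (block_rot p k) {1..<k}"
proof (rule linorder_inj_onI)
  fix t u assume "t < u" "t \<in> {1..<k}" "u \<in> {1..<k}"
  then show "block_rot p k t \<noteq> block_rot p k u"
    using block_rot_reverses[of t u k p] block_rot_preserves[of t u k p]
    by (metis atLeastLessThan_iff less_irrefl)
qed auto

text \<open>The largest start up to \<open>t\<close> begins the block of \<open>t\<close>;
  \<open>p 1\<close> guarantees that there is one.\<close>

lemma block_start:
  assumes "p 1" "1 \<le> (t::nat)"
  obtains a where "1 \<le> a" "a \<le> t" "p a" "\<And>v. a < v \<Longrightarrow> v \<le> t \<Longrightarrow> \<not> p v"
proof -
  define a where "a = (GREATEST e. p e \<and> 1 \<le> e \<and> e \<le> t)"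
  have "p a \<and> 1 \<le> a \<and> a \<le> t"
    unfolding a_def by (rule GreatestI_nat[where k = 1 and b = t]) (use assms in auto)
  moreover have "\<not> p v" if "a < v" "v \<le> t" for v
  proof
    assume "p v"
    then have "v \<le> a"
      unfolding a_def by (rule Greatest_le_nat[where b = t, OF conjI]) (use that in auto)
    then show False using that by simp
  qed
  ultimately show ?thesis using that by auto
qed

text \<open>A block start and an inner element of smaller image were exchanged by the rotation iff no other
  block start lies between their images; so the image and the types determine the original order.\<close>

lemma block_rot_between_reversed:
  assumes "1 \<le> t" "t < u" "u < k" "block_rot p k u < block_rot p k t"
    and v: "1 \<le> v" "v < k" "p v" "block_rot p k u < block_rot p k v"
    "block_rot p k v < block_rot p k t"
  shows False
proof -
  have t: "p t" "\<And>w. t < w \<Longrightarrow> w \<le> u \<Longrightarrow> \<not> p w"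
    using assms(1-4) block_rot_less_iff by blast+
  \<comment> \<open>A start after \<open>t\<close> stays above the image of \<open>t\<close>. A
    start before \<open>t\<close> stays below the image of \<open>u\<close>, since the start
    \<open>t\<close> separates it from \<open>u\<close>. Neither fits in between.\<close>
  have "v < t"
  proof (rule ccontr)
    assume "\<not> v < t"
    with v have "t < v" by (metis less_irrefl linorder_neqE_nat)
    then have "block_rot p k t < block_rot p k v"
      using block_rot_preserves[of t v k p] assms by auto
    with v show False by simp
  qed
  then have "block_rot p k v < block_rot p k u"
    using t(1) assms by (intro block_rot_preserves) auto
  with v show False by simp
qed

lemma block_rot_between_preserved:
  assumes "p 1" "1 \<le> t" "t < u" "u < k" "\<not> p t" "p u"
  obtains v where "1 \<le> v" "v < k" "p v" "block_rot p k t < block_rot p k v"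
    "block_rot p k v < block_rot p k u"
proof -
  \<comment> \<open>The witness is the start \<open>a\<close> of the block of \<open>t\<close>: it
    jumps over \<open>t\<close>, but not over \<open>u\<close>, which starts a later block.\<close>
  obtain a where a: "1 \<le> a" "a \<le> t" "p a" "\<And>v. a < v \<Longrightarrow> v \<le> t \<Longrightarrow> \<not> p v"
    using block_start[of p t] assms by auto
  have "a \<noteq> t" using a assms by auto
  then have "block_rot p k t < block_rot p k a"
    using block_rot_reverses[of a t k p] a assms by auto
  moreover have "block_rot p k a < block_rot p k u"
    using a assms by (intro block_rot_preserves exI[of _ u]) auto
  ultimately show ?thesis
    using that[of a] a assms by auto
qed

section \<open>The path as a cut\<close>

lemma lattice_path_Cons: "\<exists>ps. lattice_path T x y = (x, y) # ps"
  by (cases "(T, x, y)" rule: lattice_path.cases) auto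

lemma lattice_path_height: "q \<in> set (lattice_path T x y) \<Longrightarrow> snd q \<le> y"
  by (induction T x y rule: lattice_path.induct) (auto split: if_splits)

lemma sublist_pair_Cons:
  "sublist [a, b] (u # v # w) \<longleftrightarrow> a = u \<and> b = v \<or> sublist [a, b] (v # w)"
  by (auto simp: sublist_Cons_right)

text \<open>A step that stays at height \<open>h\<close> is no South step; \<open>1 \<le> i\<close>
  keeps the heights \<open>i\<close> and \<open>i - 1\<close> distinct.\<close>

lemma crossing_Cons_West:
  assumes "1 \<le> i"
  shows "crossing ((x, h) # lattice_path T x' h) i = crossing (lattice_path T x' h) i"
proof -
  obtain ps where ps: "lattice_path T x' h = (x', h) # ps"
    using lattice_path_Cons by blast
  have "sublist [(X, i), (X, i - 1)] ((x, h) # lattice_path T x' h)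
      \<longleftrightarrow> sublist [(X, i), (X, i - 1)] (lattice_path T x' h)" for X
    using assms by (auto simp: ps sublist_pair_Cons)
  then show ?thesis by (simp add: crossing_def)
qed

lemma crossing_Cons_South:
  assumes "1 \<le> i" "i \<le> Suc y"
  shows "crossing ((x, Suc y) # lattice_path T x y) i
    = (if i = Suc y then x else crossing (lattice_path T x y) i)"
proof -
  obtain ps where ps: "lattice_path T x y = (x, y) # ps"
    using lattice_path_Cons by blast
  have *: "sublist [(X, i), (X, i - 1)] ((x, Suc y) # lattice_path T x y)
      \<longleftrightarrow> i = Suc y \<and> X = x \<or> sublist [(X, i), (X, i - 1)] (lattice_path T x y)" for X
    using assms by (auto simp: ps sublist_pair_Cons)
  show ?thesis
  proof (cases "i = Suc y")
    case True
    \<comment> \<open>The rest of the path has height at most \<open>y\<close>, so the first step is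
      the only crossing and \<open>THE\<close> yields \<open>x\<close>.\<close>
    have "\<not> sublist [(X, i), (X, i - 1)] (lattice_path T x y)" for X
    proof
      assume "sublist [(X, i), (X, i - 1)] (lattice_path T x y)"
      then have "(X, i) \<in> set (lattice_path T x y)"
        by (auto dest: set_mono_sublist)
      then show False
        using lattice_path_height[of "(X, i)" T x y] True by auto
    qed
    with * True show ?thesis by (simp add: crossing_def)
  next
    case False
    with * show ?thesis by (simp add: crossing_def)
  qed
qed

lemmas crossing_Cons = crossing_Cons_West crossing_Cons_South

lemma crossing_le: "1 \<le> i \<Longrightarrow> i \<le> y \<Longrightarrow> crossing (lattice_path T x y) i \<le> x"
proof (induction T x y rule: lattice_path.induct)
  case (4 T x y)
  then show ?case
    by (cases "i = Suc y") (auto simp: crossing_Cons)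
qed (auto simp: crossing_Cons)

text \<open>Lower lines are met later on the path, hence weakly further west.\<close>

lemma crossing_mono_Suc:
  "1 \<le> i \<Longrightarrow> Suc i \<le> y \<Longrightarrow>
     crossing (lattice_path T x y) i \<le> crossing (lattice_path T x y) (Suc i)"
proof (induction T x y rule: lattice_path.induct)
  case (3 T y)
  then show ?case
    using crossing_le[of i y T 0] by (auto simp: crossing_Cons)
next
  case (4 T x y)
  then show ?case
    using crossing_le[of i y T "Suc x"] by (auto simp: crossing_Cons)
qed auto

lemma crossing_mono:
  assumes "1 \<le> i" "i \<le> i'" "i' \<le> y"
  shows "crossing (lattice_path T x y) i \<le> crossing (lattice_path T x y) i'"
  using assms(2,3)
proof (induction i' rule: dec_induct)
  case (step m)
  then show ?case
    using crossing_mono_Suc[of m y T x] assms(1) by auto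
qed auto

text \<open>The bounds on \<open>j\<close> say that the path visits \<open>(j, i)\<close> and leaves
  it West: it enters height \<open>i\<close> at the crossing above, or at \<open>x\<close> if it
  starts there. The two contents are those compared at this point.\<close>

lemma crossing_West_rule:
  "1 \<le> i \<Longrightarrow> i \<le> y \<Longrightarrow> crossing (lattice_path T x y) i < j \<Longrightarrow>
     j \<le> (if i = y then x else crossing (lattice_path T x y) (Suc i)) \<Longrightarrow>
     \<not> T (Suc i, j) < T (i, Suc j)"
proof (induction T x y rule: lattice_path.induct)
  case (3 T y)
  then show ?case
    by (auto simp: crossing_Cons split: if_splits)
next
  case (4 T x y)
  show ?case
  proof (cases "T (Suc y, Suc (Suc x)) > T (Suc (Suc y), Suc x)")
    case True
    then show ?thesis
      using 4 by (auto simp: crossing_Cons split: if_splits)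
  next
    case False
    show ?thesis
    proof (cases "i = Suc y \<and> j = Suc x")
      case True
      with False show ?thesis by auto
    next
      case no: False
      then show ?thesis
        using 4 False by (auto simp: crossing_Cons split: if_splits)
    qed
  qed
qed auto

text \<open>The path leaves \<open>(j, i)\<close> South; \<open>1 \<le> j\<close> excludes the axis,
  where it does so without a comparison.\<close>

lemma crossing_South_rule:
  "1 \<le> i \<Longrightarrow> i \<le> y \<Longrightarrow> crossing (lattice_path T x y) i = j \<Longrightarrow> 1 \<le> j \<Longrightarrow>
     T (Suc i, j) < T (i, Suc j)"
proof (induction T x y rule: lattice_path.induct)
  case (3 T y)
  then show ?case
    by (auto simp: crossing_Cons split: if_splits)
next
  case (4 T x y)
  then show ?case
    by (auto simp: crossing_Cons split: if_splits)
qed auto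

section \<open>Cells below the path\<close>

lemma below_iff:
  assumes "cell_of T k = (r, s)"
  shows "below T k (i, j) \<longleftrightarrow>
    1 \<le> i \<and> i < r \<and> crossing (lattice_path T (s - 1) (r - 1)) i < j"
proof -
  have "real j - 1/2 > real x \<longleftrightarrow> x < j" for x :: nat
    by linarith
  then show ?thesis
    using assms by (simp add: below_def tpath_def)
qed

lemma below_SE:
  assumes "below T k (i, j)" "1 \<le> i'" "i' \<le> i" "j \<le> j'"
  shows "below T k (i', j')"
proof -
  obtain r s where rs: "cell_of T k = (r, s)" by force
  have "crossing (lattice_path T (s - 1) (r - 1)) i' \<le> crossing (lattice_path T (s - 1) (r - 1)) i"
    using assms by (intro crossing_mono) (auto simp: below_iff[OF rs])
  then show ?thesis
    using assms by (auto simp: below_iff[OF rs])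
qed

text \<open>The path starts at abscissa \<open>s - 1\<close> and never moves East.\<close>

lemma below_right:
  assumes "cell_of T k = (r, s)" "1 \<le> i" "i < r" "s \<le> j" "1 \<le> s"
  shows "below T k (i, j)"
proof -
  have "crossing (lattice_path T (s - 1) (r - 1)) i \<le> s - 1"
    using assms by (intro crossing_le) auto
  then show ?thesis
    using assms by (auto simp: below_iff[OF assms(1)])
qed

lemma below_row: "cell_of T k = (r, s) \<Longrightarrow> below T k (i, j) \<Longrightarrow> i < r"
  by (simp add: below_iff)

text \<open>The path runs along the top edge of the cell \<open>(i, j)\<close>, so it left the upper
  right corner \<open>(j, i)\<close> West; \<open>j < s\<close> matters when \<open>i\<close> is the
  starting height.\<close>

lemma below_West_rule:
  assumes rs: "cell_of T k = (r, s)" and "below T k (i, j)" "\<not> below T k (Suc i, j)" "j < s"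
  shows "\<not> T (Suc i, j) < T (i, Suc j)"
  by (rule crossing_West_rule[where x = "s - 1" and y = "r - 1"])
     (use assms in \<open>auto simp: below_iff[OF rs]\<close>)

text \<open>The path runs down the right edge of the cell \<open>(i, j)\<close>, so it left the
  upper right corner \<open>(j, i)\<close> South.\<close>

lemma below_South_rule:
  assumes rs: "cell_of T k = (r, s)" and "1 \<le> j" "\<not> below T k (i, j)" "below T k (i, Suc j)"
  shows "T (Suc i, j) < T (i, Suc j)"
  by (rule crossing_South_rule[where x = "s - 1" and y = "r - 1"])
     (use assms in \<open>auto simp: below_iff[OF rs]\<close>)

section \<open>Standard Young tableaux\<close>

locale young_shape =
  fixes lam :: "nat list"
  assumes decreasing: "sorted_wrt (\<ge>) lam"
begin

abbreviation "D \<equiv> diagram lam"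
abbreviation "N \<equiv> sum_list lam"

lemma diagram_down:
  assumes "(i, j) \<in> D" "1 \<le> i'" "i' \<le> i" "1 \<le> j'" "j' \<le> j"
  shows "(i', j') \<in> D"
proof -
  have "lam ! (i - 1) \<le> lam ! (i' - 1)"
  proof (cases "i' = i")
    case False
    then show ?thesis
      using sorted_wrt_nth_less[OF decreasing, of "i' - 1" "i - 1"] assms
      by (auto simp: diagram_def)
  qed auto
  then show ?thesis
    using assms by (auto simp: diagram_def)
qed

lemma finite_diagram: "finite D"
proof (rule finite_subset)
  show "D \<subseteq> (SIGMA i:{..length lam}. {..lam ! (i - 1)})"
    by (auto simp: diagram_def)
qed auto

lemma SYT_bij: "T \<in> SYT lam \<Longrightarrow> bij_betw T D {1..N}"
  and SYT_outside: "T \<in> SYT lam \<Longrightarrow> c \<notin> D \<Longrightarrow> T c = 0"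
  and SYT_row: "T \<in> SYT lam \<Longrightarrow> (i, j) \<in> D \<Longrightarrow> (i, j') \<in> D \<Longrightarrow> j < j' \<Longrightarrow> T (i, j) < T (i, j')"
  and SYT_col: "T \<in> SYT lam \<Longrightarrow> (i, j) \<in> D \<Longrightarrow> (i', j) \<in> D \<Longrightarrow> i < i' \<Longrightarrow> T (i, j) < T (i', j)"
  unfolding SYT_def by blast+

lemma SYT_range: "T \<in> SYT lam \<Longrightarrow> c \<in> D \<Longrightarrow> 1 \<le> T c \<and> T c \<le> N"
  using bij_betwE[OF SYT_bij[of T]] by auto

lemma SYT_pos: "T \<in> SYT lam \<Longrightarrow> 1 \<le> T c \<Longrightarrow> c \<in> D"
  using SYT_outside[of T c] by force

lemma SYT_inj: "T \<in> SYT lam \<Longrightarrow> c \<in> D \<Longrightarrow> d \<in> D \<Longrightarrow> T c = T d \<Longrightarrow> c = d"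
  using SYT_bij[of T] unfolding bij_betw_def by (meson inj_onD)

lemma cell_of_content:
  assumes "T \<in> SYT lam" "c \<in> D"
  shows "cell_of T (T c) = c"
  unfolding cell_of_def
proof (rule the_equality)
  fix d assume "T d = T c"
  moreover have "d \<in> D"
    using SYT_pos[OF assms(1), of d] SYT_range[OF assms] \<open>T d = T c\<close> by simp
  ultimately show "d = c"
    using SYT_inj[OF assms(1)] assms(2) by blast
qed simp

lemma cell_of_props:
  assumes "T \<in> SYT lam" "1 \<le> k" "k \<le> N"
  shows "cell_of T k \<in> D" "T (cell_of T k) = k"
proof -
  have "k \<in> T ` D"
    using bij_betw_imp_surj_on[OF SYT_bij[OF assms(1)]] assms by simp
  then obtain c where "c \<in> D" "T c = k"
    by auto
  then show "cell_of T k \<in> D" "T (cell_of T k) = k"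
    using cell_of_content[of T c] assms by auto
qed

lemma SYT_mono:
  assumes T: "T \<in> SYT lam" and ij: "(i, j) \<in> D" and ij': "(i', j') \<in> D"
    and le: "i \<le> i'" "j \<le> j'" and neq: "(i, j) \<noteq> (i', j')"
  shows "T (i, j) < T (i', j')"
proof -
  have "1 \<le> i" "1 \<le> j" using ij by (auto simp: diagram_def)
  then have mid: "(i, j') \<in> D"
    using diagram_down[OF ij', of i j'] le by simp
  have row: "j < j' \<Longrightarrow> T (i, j) < T (i, j')"
    using SYT_row[OF T ij mid] .
  have col: "i < i' \<Longrightarrow> T (i, j') < T (i', j')"
    using SYT_col[OF T mid ij'] .
  show ?thesis
  proof (cases "i = i'")
    case True
    then show ?thesis using row neq le by simp
  next
    case False
    then have "T (i, j') < T (i', j')" using col le by simp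
    then show ?thesis using row le by (cases "j = j'") auto
  qed
qed

lemma origin_in: "c \<in> D \<Longrightarrow> (1, 1) \<in> D"
  using diagram_down[of "fst c" "snd c" 1 1] by (auto simp: diagram_def)

lemma origin_content:
  assumes T: "T \<in> SYT lam" and "1 \<le> N"
  shows "T (1, 1) = 1"
proof (rule ccontr)
  assume neq: "T (1, 1) \<noteq> 1"
  define c where "c = cell_of T 1"
  have c: "c \<in> D" "T c = 1"
    using cell_of_props[OF T, of 1] assms by (auto simp: c_def)
  obtain i j where ij: "c = (i, j)" by force
  have "T (1, 1) < T (i, j)"
    using neq c ij origin_in[OF c(1)] by (intro SYT_mono[OF T]) (auto simp: diagram_def)
  then show False
    using SYT_range[OF T origin_in[OF c(1)]] c ij by auto
qed

lemma cell_of_1: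
  assumes T: "T \<in> SYT lam" and N: "1 \<le> N"
  shows "cell_of T 1 = (1, 1)"
proof -
  have "(1, 1) \<in> D"
    using cell_of_props(1)[OF T, of 1] N by (intro origin_in) auto
  then show ?thesis
    using cell_of_content[OF T, of "(1, 1)"] by (simp only: origin_content[OF T N])
qed

section \<open>The map \<open>Psi\<close>\<close>

text \<open>These contents are the block starts, and this is the predicate given to
  \<open>block_rot\<close>.\<close>

definition near :: "filling \<Rightarrow> nat \<Rightarrow> nat \<Rightarrow> bool" where
  "near T k t \<longleftrightarrow> same_side T k (cell_of T t) (1, 1)"

lemma near_1: "T \<in> SYT lam \<Longrightarrow> 1 \<le> N \<Longrightarrow> near T k 1"
  using cell_of_1[of T] by (simp add: near_def same_side_def)

lemma near_content:
  "T \<in> SYT lam \<Longrightarrow> c \<in> D \<Longrightarrow> near T k (T c) \<longleftrightarrow> (below T k c \<longleftrightarrow> below T k (1, 1))"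
  by (simp add: near_def cell_of_content same_side_def)

text \<open>A start is never an inner element, so blocks sharing a content have the same start;
  maximality then fixes the length.\<close>

lemma is_block_unique:
  assumes "is_block T k a m" "is_block T k a' m'" "t \<in> {a..a + m}" "t \<in> {a'..a' + m'}"
  shows "a = a' \<and> m = m'"
proof -
  have start: "b \<le> b'"
    if "is_block T k b l" "is_block T k b' l'" "t \<in> {b..b + l}" "t \<in> {b'..b' + l'}" for b b' l l'
  proof (rule ccontr)
    assume "\<not> b \<le> b'"
    then have "b - b' \<in> {1..l'}" "b' + (b - b') = b" using that by auto
    then show False using that unfolding is_block_def by metis
  qed
  have a: "a = a'"
    using start assms by (meson antisym)
  have len: "l \<le> l'" if "is_block T k b l" "is_block T k b l'" for b l l'
  proof (rule ccontr)
    assume "\<not> l \<le> l'"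
    then have "l' + 1 \<in> {1..l}" by auto
    then have "\<not> same_side T k (cell_of T (b + (l' + 1))) (1, 1)"
      using that unfolding is_block_def by blast
    moreover have "b + l' + 1 < k"
      using that \<open>\<not> l \<le> l'\<close> unfolding is_block_def by auto
    ultimately show False
      using that unfolding is_block_def by (metis add.assoc)
  qed
  then show ?thesis
    using a assms by (metis antisym)
qed

text \<open>The content lies between the last start \<open>a\<close> and the image \<open>e\<close>
  of \<open>a\<close>; by \<open>is_block_unique\<close>, the \<open>THE\<close> in
  \<open>Psi\<close> picks this block.\<close>

lemma Psi_eq:
  assumes T: "T \<in> SYT lam" and N: "1 \<le> N"
  shows "Psi k T c = (if 1 \<le> T c \<and> T c < k then block_rot (near T k) k (T c) else T c)"
proof (cases "1 \<le> T c \<and> T c < k")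
  case True
  define t where "t = T c"
  have t: "1 \<le> t" "t < k" using True by (auto simp: t_def)
  obtain a where a: "1 \<le> a" "a \<le> t" "near T k a" "\<And>v. a < v \<Longrightarrow> v \<le> t \<Longrightarrow> \<not> near T k v"
    using block_start[of "near T k" t] near_1[OF T N] t by blast
  define e where "e = block_rot (near T k) k a"
  have e: "a \<le> e" "e < k" "\<And>v. a < v \<Longrightarrow> v \<le> e \<Longrightarrow> \<not> near T k v" "e + 1 < k \<Longrightarrow> near T k (e + 1)"
    using block_rot_start[of "near T k" a k] a t unfolding e_def by auto
  \<comment> \<open>Otherwise \<open>e + 1\<close> would be a start after \<open>a\<close> and not
    after \<open>t\<close>.\<close>
  have te: "t \<le> e"
  proof (rule ccontr)
    assume "\<not> t \<le> e"
    then show False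
      using a(4)[of "e + 1"] e t by auto
  qed
  have block: "is_block T k a (e - a)"
    using a e unfolding is_block_def near_def[symmetric] by auto
  have the: "(THE (a, m). is_block T k a m \<and> t \<in> {a..a + m}) = (a, e - a)"
  proof (rule the_equality)
    show "case (a, e - a) of (a, m) \<Rightarrow> is_block T k a m \<and> t \<in> {a..a + m}"
      using block a te by auto
  next
    fix y assume "case y of (a, m) \<Rightarrow> is_block T k a m \<and> t \<in> {a..a + m}"
    then show "y = (a, e - a)"
      using is_block_unique[of T k "fst y" "snd y" a "e - a" t] block a te
      by (cases y) auto
  qed
  have "block_rot (near T k) k t = (if t = a then e else t - 1)"
    using a(4)[of t] a e_def by (auto simp: block_rot_inner le_less)
  then show ?thesis
    using True the e by (auto simp: Psi_def t_def[symmetric])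
next
  case False
  then show ?thesis by (auto simp: Psi_def)
qed

lemma Psi_large: "k \<le> T c \<Longrightarrow> Psi k T c = T c"
  by (simp add: Psi_def)

lemma Psi_small:
  assumes "T \<in> SYT lam" "c \<in> D" "T c < k"
  shows "1 \<le> Psi k T c" "Psi k T c < k"
proof -
  have "1 \<le> T c" "1 \<le> N" using SYT_range[OF assms(1,2)] by auto
  then show "1 \<le> Psi k T c" "Psi k T c < k"
    using block_rot_range[of "near T k" "T c" k] near_1[OF assms(1)] Psi_eq[OF assms(1)] assms by auto
qed

lemma Psi_inner:
  assumes "T \<in> SYT lam" "c \<in> D" "T c < k" "\<not> near T k (T c)"
  shows "Psi k T c = T c - 1"
proof -
  have "1 \<le> T c" "1 \<le> N" using SYT_range[OF assms(1,2)] by auto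
  then show ?thesis using Psi_eq[OF assms(1)] assms by (auto simp: block_rot_inner)
qed

lemma Psi_eq_rot:
  assumes "T \<in> SYT lam" "c \<in> D" "T c < k"
  shows "Psi k T c = block_rot (near T k) k (T c)"
proof -
  have "1 \<le> T c" "1 \<le> N" using SYT_range[OF assms(1,2)] by auto
  then show ?thesis using Psi_eq[OF assms(1)] assms by auto
qed

lemma Psi_preserves:
  assumes T: "T \<in> SYT lam" and "c \<in> D" "d \<in> D" "T c < T d"
    and sep: "T d < k \<Longrightarrow> near T k (T c) \<Longrightarrow> \<exists>e\<in>D. T c < T e \<and> T e \<le> T d \<and> near T k (T e)"
  shows "Psi k T c < Psi k T d"
proof (cases "T d < k")
  case True
  have "block_rot (near T k) k (T c) < block_rot (near T k) k (T d)"
    using sep True assms SYT_range[OF T, of c] by (intro block_rot_preserves) auto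
  then show ?thesis
    using assms True by (simp add: Psi_eq_rot)
next
  case False
  then show ?thesis
    using assms Psi_small[OF T, of c k] Psi_large[of k T c] Psi_large[of k T d]
    by (cases "T c < k") auto
qed

lemma cell_coords:
  assumes "T \<in> SYT lam" "1 \<le> k" "k \<le> N" "cell_of T k = (r, s)"
  shows "(r, s) \<in> D" "T (r, s) = k" "1 \<le> r" "1 \<le> s"
  using cell_of_props[OF assms(1-3)] assms(4) by (auto simp: diagram_def)

text \<open>Adjacent cells suffice. If the path separates a start from its right or upper neighbour,
  the other neighbour is smaller and on the side of the start, hence itself a start in
  between.\<close>

lemma Psi_in_SYT:
  assumes T: "T \<in> SYT lam" and k: "1 \<le> k" "k \<le> N"
  shows "Psi k T \<in> SYT lam"
proof -
  obtain r s where rs: "cell_of T k = (r, s)" by force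
  note cr = cell_coords[OF T k rs]
  \<comment> \<open>Both neighbours are still weakly southwest of the cell of \<open>k\<close> and
    different from it.\<close>
  have NE: "(Suc i, j) \<in> D" "T (Suc i, j) < k" "(i, Suc j) \<in> D" "T (i, Suc j) < k"
    if "1 \<le> i" "1 \<le> j" "i < r" "j < s" for i j
  proof -
    show *: "(Suc i, j) \<in> D" "(i, Suc j) \<in> D"
      using that cr by (auto intro: diagram_down[of r s])
    show "T (Suc i, j) < k" "T (i, Suc j) < k"
      using SYT_mono[OF T *(1) cr(1)] SYT_mono[OF T *(2) cr(1)] that cr by auto
  qed
  have row: "Psi k T (i, j) < Psi k T (i, Suc j)" if ij: "(i, j) \<in> D" "(i, Suc j) \<in> D" for i j
  proof (rule Psi_preserves[OF T ij])
    show less: "T (i, j) < T (i, Suc j)"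
      using SYT_row[OF T] ij by auto
    assume small: "T (i, Suc j) < k" and nr: "near T k (T (i, j))"
    have ge1: "1 \<le> i" "1 \<le> j" using ij by (auto simp: diagram_def)
    show "\<exists>e\<in>D. T (i, j) < T e \<and> T e \<le> T (i, Suc j) \<and> near T k (T e)"
    proof (cases "below T k (i, j) = below T k (i, Suc j)")
      case True
      then show ?thesis
        using nr less ij by (intro bexI[of _ "(i, Suc j)"]) (auto simp: near_content[OF T])
    next
      case False
      \<comment> \<open>The path runs down the common edge, so the South rule makes the upper
        neighbour the smaller one.\<close>
      then have b: "\<not> below T k (i, j)" "below T k (i, Suc j)"
        using below_SE[of T k i j i "Suc j"] ge1 by auto
      have "i < r" using below_row[OF rs b(2)] .
      moreover have "j < s"
        using below_right[OF rs, of i j] b ge1 cr \<open>i < r\<close> by force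
      ultimately have ne: "(Suc i, j) \<in> D" "T (Suc i, j) < k" using NE ge1 by auto
      have "T (Suc i, j) < T (i, Suc j)"
        using below_South_rule[OF rs ge1(2) b] .
      moreover have "T (i, j) < T (Suc i, j)"
        using SYT_col[OF T] ij ne by auto
      moreover have "\<not> below T k (Suc i, j)"
        using b below_SE[of T k "Suc i" j i j] ge1 by auto
      ultimately show ?thesis
        using nr ij ne b by (intro bexI[of _ "(Suc i, j)"]) (auto simp: near_content[OF T])
    qed
  qed
  have col: "Psi k T (i, j) < Psi k T (Suc i, j)" if ij: "(i, j) \<in> D" "(Suc i, j) \<in> D" for i j
  proof (rule Psi_preserves[OF T ij])
    show less: "T (i, j) < T (Suc i, j)"
      using SYT_col[OF T] ij by auto
    assume small: "T (Suc i, j) < k" and nr: "near T k (T (i, j))"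
    have ge1: "1 \<le> i" "1 \<le> j" using ij by (auto simp: diagram_def)
    show "\<exists>e\<in>D. T (i, j) < T e \<and> T e \<le> T (Suc i, j) \<and> near T k (T e)"
    proof (cases "below T k (i, j) = below T k (Suc i, j)")
      case True
      then show ?thesis
        using nr less ij by (intro bexI[of _ "(Suc i, j)"]) (auto simp: near_content[OF T])
    next
      case False
      \<comment> \<open>The path runs along the common edge, so the West rule makes the right
        neighbour the smaller one.\<close>
      then have b: "below T k (i, j)" "\<not> below T k (Suc i, j)"
        using below_SE[of T k "Suc i" j i j] ge1 by auto
      have "i < r" using below_row[OF rs b(1)] .
      \<comment> \<open>Otherwise \<open>(Suc i, j)\<close>, being above the path, would lie weakly
        northeast of the cell of \<open>k\<close>, although its content is less than
        \<open>k\<close>.\<close>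
      moreover have "j < s"
      proof (rule ccontr)
        assume "\<not> j < s"
        then have "(r, s) = (Suc i, j) \<or> T (r, s) < T (Suc i, j)"
          if "r \<le> Suc i"
          using SYT_mono[OF T cr(1) ij(2)] that by auto
        moreover have "r \<le> Suc i"
          using below_right[OF rs, of "Suc i" j] b cr \<open>\<not> j < s\<close> by force
        ultimately show False using small cr by auto
      qed
      ultimately have ne: "(i, Suc j) \<in> D" "T (i, Suc j) < k" "(Suc i, j) \<in> D" using NE ge1 by auto
      have "\<not> T (Suc i, j) < T (i, Suc j)"
        using below_West_rule[OF rs b \<open>j < s\<close>] .
      moreover have "T (i, j) < T (i, Suc j)"
        using SYT_row[OF T] ij ne by auto
      moreover have "below T k (i, Suc j)"
        using b below_SE[of T k i j i "Suc j"] ge1 by auto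
      ultimately show ?thesis
        using nr ij ne b by (intro bexI[of _ "(i, Suc j)"]) (auto simp: near_content[OF T])
    qed
  qed
  have rows: "Psi k T (i, j) < Psi k T (i, j')"
    if "(i, j) \<in> D" "(i, j') \<in> D" "j < j'" for i j j'
  proof -
    from that(3) have "Suc j \<le> j'" by simp
    then show ?thesis
      using that(2)
    proof (induction j' rule: dec_induct)
      case base
      then show ?case using row that(1) by auto
    next
      case (step m)
      then have "(i, m) \<in> D"
        using that(1) by (intro diagram_down[of i "Suc m" i m]) (auto simp: diagram_def)
      then show ?case using row[of i m] step by auto
    qed
  qed
  have cols: "Psi k T (i, j) < Psi k T (i', j)"
    if "(i, j) \<in> D" "(i', j) \<in> D" "i < i'" for i i' j
  proof -
    from that(3) have "Suc i \<le> i'" by simp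
    then show ?thesis
      using that(2)
    proof (induction i' rule: dec_induct)
      case base
      then show ?case using col that(1) by auto
    next
      case (step m)
      then have "(m, j) \<in> D"
        using that(1) by (intro diagram_down[of "Suc m" j m j]) (auto simp: diagram_def)
      then show ?case using col[of m j] step by auto
    qed
  qed
  have inj: "inj_on (Psi k T) D"
  proof (rule inj_onI)
    fix c d assume cd: "c \<in> D" "d \<in> D" "Psi k T c = Psi k T d"
    have "T c = T d"
    proof (cases "T c < k \<and> T d < k")
      case True
      then show ?thesis
        using cd SYT_range[OF T, of c] SYT_range[OF T, of d] inj_on_block_rot[of "near T k" k]
        by - (rule inj_onD[of "block_rot (near T k) k" "{1..<k}" "T c" "T d"], auto simp: Psi_eq_rot[OF T])
    next
      case False
      then show ?thesis
        using cd Psi_small(2)[OF T, of c k] Psi_small(2)[OF T, of d k]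
          Psi_large[of k T c] Psi_large[of k T d]
        by linarith
    qed
    then show "c = d" using SYT_inj[OF T] cd by auto
  qed
  have "Psi k T ` D \<subseteq> {1..N}"
  proof
    fix x assume "x \<in> Psi k T ` D"
    then obtain c where "c \<in> D" "x = Psi k T c" by auto
    then show "x \<in> {1..N}"
      using Psi_small[OF T, of c k] Psi_large[of k T c] SYT_range[OF T, of c] k
      by (cases "T c < k") auto
  qed
  moreover have "card (Psi k T ` D) = card {1..N}"
    using card_image[OF inj] bij_betw_same_card[OF SYT_bij[OF T]] by simp
  ultimately have "Psi k T ` D = {1..N}"
    by (intro card_subset_eq) auto
  with inj have "bij_betw (Psi k T) D {1..N}"
    by (simp add: bij_betw_def)
  moreover have "Psi k T c = 0" if "c \<notin> D" for c
    using that SYT_outside[OF T] by (simp add: Psi_def)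
  ultimately show ?thesis
    using rows cols by (simp add: SYT_def)
qed

section \<open>Injectivity of \<open>Psi\<close>\<close>

lemma Psi_content_less_iff:
  assumes "T \<in> SYT lam" "c \<in> D"
  shows "Psi k T c < k \<longleftrightarrow> T c < k"
  using Psi_small[OF assms, of k] Psi_large[of k T c] by force

lemma cell_of_Psi:
  assumes T: "T \<in> SYT lam" and k: "1 \<le> k" "k \<le> l" "l \<le> N"
  shows "cell_of (Psi k T) l = cell_of T l"
proof -
  have "cell_of T l \<in> D" "T (cell_of T l) = l"
    using cell_of_props[OF T, of l] k by auto
  then show ?thesis
    using cell_of_content[OF Psi_in_SYT[OF T], of k "cell_of T l"] Psi_large[of k T] k by auto
qed

text \<open>On the side of the origin cell the larger content is itself a separating start; on the
  other side the smaller one is no start.\<close>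

lemma Psi_same_side:
  assumes T: "T \<in> SYT lam" and cd: "c \<in> D" "d \<in> D" "T c < k" "T d < k"
    and side: "below T k c = below T k d"
  shows "Psi k T c < Psi k T d \<longleftrightarrow> T c < T d"
proof -
  have *: "Psi k T x < Psi k T y"
    if "x \<in> D" "y \<in> D" "T x < T y" "below T k x = below T k y" for x y
    using that by (intro Psi_preserves[OF T that(1,2,3)] bexI[of _ y]) (auto simp: near_content[OF T])
  show ?thesis
    using *[of c d] *[of d c] side cd SYT_inj[OF T, of c d]
    by (metis less_asym linorder_neqE_nat)
qed

definition near_cell :: "filling \<Rightarrow> nat \<Rightarrow> cell \<Rightarrow> bool" where
  "near_cell T k c \<longleftrightarrow> (below T k c \<longleftrightarrow> below T k (1, 1))"


text \<open>If \<open>d\<close> precedes \<open>c\<close>, the start of the block of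
  \<open>d\<close> lands between them. If \<open>c\<close> precedes \<open>d\<close>, either the
  images keep this order or no start lands between them. Thus image and sides recover the
  order.\<close>

lemma Psi_order:
  assumes T: "T \<in> SYT lam" and "1 \<le> k" "k \<le> N"
    and c: "c \<in> D" "T c < k" "near_cell T k c" and d: "d \<in> D" "T d < k" "\<not> near_cell T k d"
  shows "T d < T c \<longleftrightarrow> Psi k T d < Psi k T c \<and>
    (\<exists>e\<in>D. near_cell T k e \<and> Psi k T d < Psi k T e \<and> Psi k T e < Psi k T c)"
    (is "_ \<longleftrightarrow> ?R")
proof
  have N: "1 \<le> N" using assms by simp
  have nr: "near T k (T x) \<longleftrightarrow> near_cell T k x" if "x \<in> D" for x
    using that by (simp add: near_content[OF T] near_cell_def)
  have range: "1 \<le> T x" if "x \<in> D" for x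
    using SYT_range[OF T that] by simp
  have dc: "1 \<le> T d" "1 \<le> T c" "\<not> near T k (T d)" "near T k (T c)"
    using range nr c d by auto
  {
    assume less: "T d < T c"
    obtain v where v: "1 \<le> v" "v < k" "near T k v"
      "block_rot (near T k) k (T d) < block_rot (near T k) k v"
      "block_rot (near T k) k v < block_rot (near T k) k (T c)"
      by (rule block_rot_between_preserved[of "near T k" "T d" "T c" k])
         (use less c d dc near_1[OF T N] in auto)
    define e where "e = cell_of T v"
    have e: "e \<in> D" "T e = v"
      using cell_of_props[OF T, of v] v assms by (auto simp: e_def)
    have "near_cell T k e" using v nr[OF e(1)] e by simp
    moreover have "Psi k T d < Psi k T e" "Psi k T e < Psi k T c"
      using v c d e by (auto simp: Psi_eq_rot[OF T])
    ultimately show ?R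
      using e(1) by (auto intro: less_trans)
  }
  assume R: ?R
  then obtain e where e: "e \<in> D" "near_cell T k e" "Psi k T d < Psi k T e" "Psi k T e < Psi k T c"
    by auto
  have "Psi k T c < k" using c Psi_small[OF T] by auto
  then have ek: "T e < k" using e Psi_content_less_iff[OF T e(1), of k] by auto
  have rots: "block_rot (near T k) k (T d) < block_rot (near T k) k (T e)"
     "block_rot (near T k) k (T e) < block_rot (near T k) k (T c)"
    using e ek c d by (auto simp: Psi_eq_rot[OF T])
  show "T d < T c"
  proof (rule ccontr)
    assume "\<not> T d < T c"
    moreover have "T c \<noteq> T d" using c d SYT_inj[OF T, of c d] by auto
    ultimately have less: "T c < T d" by simp
    show False
    proof (rule block_rot_between_reversed[OF dc(2) less d(2)])
      show "1 \<le> T e" "T e < k" "near T k (T e)" using range e ek nr by auto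
    qed (use rots in auto)
  qed
qed

text \<open>The right-hand side is the descent condition at \<open>k - 1\<close>; it depends on the
  image only, since \<open>Psi k\<close> fixes the cell of \<open>k\<close>.\<close>

lemma Psi_side:
  assumes T: "T \<in> SYT lam" and k: "2 \<le> k" "k \<le> N"
  shows "below T k (1, 1) \<longleftrightarrow> fst (cell_of (Psi k T) (k - 1)) < fst (cell_of T k)"
proof -
  obtain r s where rs: "cell_of T k = (r, s)" by force
  have k1: "1 \<le> k" using k by simp
  note cr = cell_coords[OF T k1 k(2) rs]
  have T': "Psi k T \<in> SYT lam" using Psi_in_SYT[OF T k1 k(2)] .
  obtain i j where ij: "cell_of (Psi k T) (k - 1) = (i, j)" by force
  have x: "(i, j) \<in> D" "Psi k T (i, j) = k - 1" "1 \<le> i" "1 \<le> j"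
    using cell_coords[OF T' _ _ ij] k by auto
  have small: "T (i, j) < k"
    using Psi_content_less_iff[OF T x(1), of k] x k by simp
  \<comment> \<open>An inner element drops by one, from at most \<open>k - 1\<close>, so
    \<open>k - 1\<close> lands on a start.\<close>
  have "near T k (T (i, j))"
  proof (rule ccontr)
    assume "\<not> near T k (T (i, j))"
    then have "Psi k T (i, j) = T (i, j) - 1"
      using Psi_inner[OF T x(1) small] by simp
    then show False
      using x small k by simp
  qed
  then have side: "below T k (i, j) \<longleftrightarrow> below T k (1, 1)"
    using near_content[OF T x(1)] by simp
  \<comment> \<open>If it were above the path, the image would put the content of
    \<open>(Suc i, j)\<close> strictly between \<open>k - 1\<close> and \<open>k\<close>.\<close>
  have "below T k (i, j)" if "i < r"
  proof (rule ccontr)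
    assume nb: "\<not> below T k (i, j)"
    then have "j < s"
      using below_right[OF rs x(3) that, of j] cr by force
    have "(Suc i, j) \<in> D"
      using diagram_down[OF cr(1), of "Suc i" j] x that \<open>j < s\<close> by simp
    moreover have "Psi k T (i, j) < Psi k T (Suc i, j)"
      using SYT_mono[OF T' x(1) \<open>(Suc i, j) \<in> D\<close>] by simp
    moreover have "Psi k T (Suc i, j) < Psi k T (r, s)"
      using SYT_mono[OF T' \<open>(Suc i, j) \<in> D\<close> cr(1)] that \<open>j < s\<close> by simp
    moreover have "Psi k T (r, s) = k"
      using Psi_large[of k T "(r, s)"] cr by simp
    ultimately show False using x by simp
  qed
  then have "below T k (1, 1) \<longleftrightarrow> i < r"
    using side below_row[OF rs, of i j] by blast
  then show ?thesis
    by (simp only: ij rs fst_conv)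
qed

text \<open>The criterion in \<open>Psi_order\<close> involves only the common image and the sides
  of cells whose image exceeds that of \<open>d\<close>.\<close>

lemma Psi_order_transfer:
  assumes T1: "T1 \<in> SYT lam" and T2: "T2 \<in> SYT lam" and k: "1 \<le> k" "k \<le> N"
    and eq: "Psi k T1 = Psi k T2" and side: "below T1 k (1, 1) = below T2 k (1, 1)"
    and c: "c \<in> D" "T1 c < k" "near_cell T1 k c" "below T1 k c = below T2 k c"
    and d: "d \<in> D" "T1 d < k" "\<not> near_cell T1 k d" "below T1 k d = below T2 k d"
    and agree: "\<And>e. e \<in> D \<Longrightarrow> Psi k T1 d < Psi k T1 e \<Longrightarrow> Psi k T1 e < k \<Longrightarrow>
      below T1 k e = below T2 k e"
  shows "T1 d < T1 c \<longleftrightarrow> T2 d < T2 c"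
proof -
  have small: "T2 c < k" "T2 d < k" "Psi k T1 c < k"
    using Psi_content_less_iff[OF T1, of c k] Psi_content_less_iff[OF T2, of c k]
      Psi_content_less_iff[OF T1, of d k] Psi_content_less_iff[OF T2, of d k] c d eq by auto
  have near: "near_cell T2 k c" "\<not> near_cell T2 k d"
    using c d side by (auto simp: near_cell_def)
  have "near_cell T1 k e = near_cell T2 k e"
    if "e \<in> D" "Psi k T1 d < Psi k T1 e" "Psi k T1 e < Psi k T1 c" for e
    using agree[OF that(1,2)] that(3) small side by (auto simp: near_cell_def)
  then show ?thesis
    unfolding Psi_order[OF T1 k c(1,2,3) d(1,2,3)]
      Psi_order[OF T2 k c(1) small(1) near(1) d(1) small(2) near(2)]
    using eq by auto
qed

text \<open>At the cell \<open>M\<close> on which two candidate paths last disagree (in the order of the common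
  image), the paths separate at the upper right corner of \<open>M\<close>: one turns South and the other
  West, so the two neighbours \<open>(i + 1, j)\<close> and \<open>(i, j + 1)\<close> have opposite orders in the two
  tableaux. But these neighbours come later than \<open>M\<close>, hence their original order is determined
  by the image.\<close>

lemma Psi_no_last_difference:
  assumes T1: "T1 \<in> SYT lam" and T2: "T2 \<in> SYT lam" and k: "1 \<le> k" "k \<le> N"
    and eq: "Psi k T1 = Psi k T2" and side: "below T1 k (1, 1) = below T2 k (1, 1)"
    and M: "M \<in> D" "\<not> below T1 k M" "below T2 k M"
    and agree: "\<And>e. e \<in> D \<Longrightarrow> Psi k T1 M < Psi k T1 e \<Longrightarrow> Psi k T1 e < k \<Longrightarrow>
      below T1 k e = below T2 k e"
  shows False
proof -
  obtain i j where ij: "M = (i, j)" by force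
  obtain r s where rs: "cell_of T1 k = (r, s)" by force
  note cr = cell_coords[OF T1 k rs]
  have rs2: "cell_of T2 k = (r, s)"
    using cell_of_Psi[OF T1 k(1) order_refl k(2)] cell_of_Psi[OF T2 k(1) order_refl k(2)] eq rs by simp
  have T': "Psi k T1 \<in> SYT lam" using Psi_in_SYT[OF T1 k] .
  have ge1: "1 \<le> i" "1 \<le> j" using M ij by (auto simp: diagram_def)
  have lt: "i < r" using below_row[OF rs2] M ij by blast
  have jt: "j < s"
    using below_right[OF rs ge1(1) lt, of j] M ij cr by force
  have A: "(Suc i, j) \<in> D" and B: "(i, Suc j) \<in> D"
    using diagram_down[OF cr(1)] ge1 lt jt by auto
  have small: "T1 (Suc i, j) < k" "T1 (i, Suc j) < k"
    using SYT_mono[OF T1 A cr(1)] SYT_mono[OF T1 B cr(1)] lt jt cr by auto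
  have larger: "Psi k T1 M < Psi k T1 (Suc i, j)" "Psi k T1 M < Psi k T1 (i, Suc j)"
    using SYT_mono[OF T' _ A, of i j] SYT_mono[OF T' _ B, of i j] M ij by auto
  have agreeA: "below T1 k (Suc i, j) = below T2 k (Suc i, j)"
    and agreeB: "below T1 k (i, Suc j) = below T2 k (i, Suc j)"
    using agree[OF A larger(1)] agree[OF B larger(2)] small
      Psi_content_less_iff[OF T1 A, of k] Psi_content_less_iff[OF T1 B, of k] by auto
  \<comment> \<open>Both paths have \<open>(Suc i, j)\<close> above and \<open>(i, Suc j)\<close>
    below, so that of \<open>T1\<close> runs down the right edge of \<open>M\<close>, that of
    \<open>T2\<close> along its top edge.\<close>
  have above: "\<not> below T1 k (Suc i, j)"
    using below_SE[of T1 k "Suc i" j i j] ge1 M ij by auto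
  have under: "below T1 k (i, Suc j)"
    using below_SE[of T2 k i j i "Suc j"] ge1 M ij agreeB by auto
  have south: "T1 (Suc i, j) < T1 (i, Suc j)"
    using below_South_rule[OF rs ge1(2) _ under] M ij by simp
  have west: "\<not> T2 (Suc i, j) < T2 (i, Suc j)"
    using below_West_rule[OF rs2 _ _ jt] above agreeA M ij by simp
  have west': "T2 (i, Suc j) < T2 (Suc i, j)"
    using west SYT_inj[OF T2 A B] by (metis Pair_inject linorder_neqE_nat n_not_Suc_n)
  show False
  \<comment> \<open>The side of the origin cell decides which of the two neighbours is the
    start.\<close>
  proof (cases "below T1 k (1, 1)")
    case False
    have "T1 (i, Suc j) < T1 (Suc i, j) \<longleftrightarrow> T2 (i, Suc j) < T2 (Suc i, j)"
      by (rule Psi_order_transfer[OF T1 T2 k eq side A small(1) _ agreeA B small(2) _ agreeB])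
         (use False above under agree larger in \<open>auto simp: near_cell_def intro: less_trans\<close>)
    then show False using south west' by simp
  next
    case True
    have "T1 (Suc i, j) < T1 (i, Suc j) \<longleftrightarrow> T2 (Suc i, j) < T2 (i, Suc j)"
      by (rule Psi_order_transfer[OF T1 T2 k eq side B small(2) _ agreeB A small(1) _ agreeA])
         (use True above under agree larger in \<open>auto simp: near_cell_def intro: less_trans\<close>)
    then show False using south west by simp
  qed
qed

section \<open>Recovering a tableau from the order of its contents\<close>

lemma SYT_rank:
  assumes T: "T \<in> SYT lam" and c: "c \<in> D"
  shows "card {d \<in> D. T d < T c} = T c - 1"
proof -
  have img: "T ` {d \<in> D. T d < T c} = {1..<T c}"
  proof (intro equalityI subsetI)
    fix x assume "x \<in> {1..<T c}"
    then show "x \<in> T ` {d \<in> D. T d < T c}"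
      using cell_of_props[OF T, of x] SYT_range[OF T c] by (intro image_eqI[of _ _ "cell_of T x"]) auto
  next
    fix x assume "x \<in> T ` {d \<in> D. T d < T c}"
    then show "x \<in> {1..<T c}"
      using SYT_range[OF T] by auto
  qed
  have "inj_on T {d \<in> D. T d < T c}"
    using SYT_inj[OF T] by (intro inj_onI) blast
  then show ?thesis
    using card_image[of T "{d \<in> D. T d < T c}"] img by simp
qed

lemma SYT_eqI:
  assumes T1: "T1 \<in> SYT lam" and T2: "T2 \<in> SYT lam"
    and ord: "\<And>c d. c \<in> D \<Longrightarrow> d \<in> D \<Longrightarrow> T1 c < T1 d \<longleftrightarrow> T2 c < T2 d"
  shows "T1 = T2"
proof
  fix c
  show "T1 c = T2 c"
  proof (cases "c \<in> D")
    case True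
    have "{d \<in> D. T1 d < T1 c} = {d \<in> D. T2 d < T2 c}"
      using ord True by blast
    then have "T1 c - 1 = T2 c - 1"
      using SYT_rank[OF T1 True] SYT_rank[OF T2 True] by simp
    then show ?thesis
      using SYT_range[OF T1 True] SYT_range[OF T2 True] by linarith
  next
    case False
    then show ?thesis
      using SYT_outside[OF T1 False] SYT_outside[OF T2 False] by simp
  qed
qed

text \<open>Among the cells on which the paths disagree, the one of largest image contradicts
  \<open>Psi_no_last_difference\<close>.\<close>

lemma Psi_eq_imp_same_sides:
  assumes T1: "T1 \<in> SYT lam" and T2: "T2 \<in> SYT lam" and k: "2 \<le> k" "k \<le> N"
    and eq: "Psi k T1 = Psi k T2"
    and c: "c \<in> D" "Psi k T1 c < k"
  shows "below T1 k c = below T2 k c"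
proof (rule ccontr)
  assume diff: "below T1 k c \<noteq> below T2 k c"
  have k1: "1 \<le> k" using k by simp
  \<comment> \<open>The row of \<open>k - 1\<close> in the common image decides the side of the
    origin cell.\<close>
  have side: "below T1 k (1, 1) = below T2 k (1, 1)"
    using Psi_side[OF T1 k] Psi_side[OF T2 k] eq
      cell_of_Psi[OF T1 k1 order_refl k(2)] cell_of_Psi[OF T2 k1 order_refl k(2)] by simp
  define X where "X = {e \<in> D. Psi k T1 e < k \<and> below T1 k e \<noteq> below T2 k e}"
  have fin: "finite X" using finite_diagram by (simp add: X_def)
  have "c \<in> X" using c diff by (simp add: X_def)
  then have ne: "X \<noteq> {}" by blast
  define m where "m = Max (Psi k T1 ` X)"
  have "m \<in> Psi k T1 ` X"
    unfolding m_def using fin ne by (intro Max_in) auto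
  then obtain M where M: "M \<in> X" "Psi k T1 M = m" by auto
  have agree: "below T1 k e = below T2 k e"
    if "e \<in> D" "Psi k T1 M < Psi k T1 e" "Psi k T1 e < k" for e
  proof (rule ccontr)
    assume "below T1 k e \<noteq> below T2 k e"
    then have "e \<in> X" using that by (simp add: X_def)
    then have "Psi k T1 e \<le> m"
      unfolding m_def using fin by (intro Max_ge) auto
    then show False using that M by simp
  qed
  have MD: "M \<in> D" using M by (simp add: X_def)
  show False
  proof (cases "below T1 k M")
    case True
    then have "\<not> below T2 k M" using M by (simp add: X_def)
    then show False
      using Psi_no_last_difference[OF T2 T1 k1 k(2) eq[symmetric] side[symmetric] MD _ True]
        agree eq by simp
  next
    case False
    then have "below T2 k M" using M by (simp add: X_def)
    then show False
      using Psi_no_last_difference[OF T1 T2 k1 k(2) eq side MD False] agree by simp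
  qed
qed

text \<open>The sides agree, so the order of every two contents below \<open>k\<close> is recovered:
  by \<open>Psi_same_side\<close> on one side, by \<open>Psi_order_transfer\<close> across the
  path.\<close>

lemma inj_on_Psi:
  assumes k: "2 \<le> k" "k \<le> N"
  shows "inj_on (Psi k) (SYT lam)"
proof (rule inj_onI)
  fix T1 T2 assume T1: "T1 \<in> SYT lam" and T2: "T2 \<in> SYT lam" and eq: "Psi k T1 = Psi k T2"
  have k1: "1 \<le> k" using k by simp
  note sides = Psi_eq_imp_same_sides[OF T1 T2 k eq]
  have small: "Psi k T1 c < k \<longleftrightarrow> T1 c < k" "T2 c < k \<longleftrightarrow> T1 c < k" if "c \<in> D" for c
    using Psi_content_less_iff[OF T1 that, of k] Psi_content_less_iff[OF T2 that, of k] eq by auto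
  have large: "T1 c = T2 c" if "c \<in> D" "\<not> T1 c < k" for c
    using Psi_large[of k T1 c] Psi_large[of k T2 c] small(2)[OF that(1)] that eq by simp
  have origin: "below T1 k (1, 1) = below T2 k (1, 1)"
    using Psi_side[OF T1 k] Psi_side[OF T2 k] eq
      cell_of_Psi[OF T1 k1 order_refl k(2)] cell_of_Psi[OF T2 k1 order_refl k(2)] by simp
  have mixed: "T1 d < T1 c \<longleftrightarrow> T2 d < T2 c"
    if "c \<in> D" "d \<in> D" "T1 c < k" "T1 d < k" "near_cell T1 k c" "\<not> near_cell T1 k d" for c d
    using Psi_order_transfer[OF T1 T2 k1 k(2) eq origin] that sides small(1) by blast
  show "T1 = T2"
  proof (rule SYT_eqI[OF T1 T2])
    fix c d assume cd: "c \<in> D" "d \<in> D"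
    have ne: "T1 c = T1 d \<longleftrightarrow> c = d" "T2 c = T2 d \<longleftrightarrow> c = d"
      using SYT_inj[OF T1 cd] SYT_inj[OF T2 cd] by auto
    show "T1 c < T1 d \<longleftrightarrow> T2 c < T2 d"
    proof (cases "T1 c < k \<and> T1 d < k")
      case False
      then show ?thesis
        using large[OF cd(1)] large[OF cd(2)] small(2)[OF cd(1)] small(2)[OF cd(2)] by linarith
    next
      case True
      have s: "below T1 k c = below T2 k c" "below T1 k d = below T2 k d"
        using sides small(1) cd True by auto
      show ?thesis
      proof (cases "below T1 k c = below T1 k d")
        case same: True
        have "T1 c < T1 d \<longleftrightarrow> Psi k T1 c < Psi k T1 d"
          using Psi_same_side[OF T1 cd _ _ same] True by simp
        also have "\<dots> \<longleftrightarrow> T2 c < T2 d"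
          using Psi_same_side[OF T2 cd] True same s small(2)[OF cd(1)] small(2)[OF cd(2)] eq by simp
        finally show ?thesis .
      next
        case opp: False
        then consider "near_cell T1 k c" "\<not> near_cell T1 k d" | "near_cell T1 k d" "\<not> near_cell T1 k c"
          by (auto simp: near_cell_def)
        then show ?thesis
        proof cases
          case 1
          then have "T1 d < T1 c \<longleftrightarrow> T2 d < T2 c" using mixed cd True by blast
          moreover have "c \<noteq> d" using opp by auto
          ultimately show ?thesis using ne by linarith
        next
          case 2
          then show ?thesis using mixed cd True by blast
        qed
      qed
    qed
  qed
qed

section \<open>Inversions\<close>

lemma Psi_comp_empty: "m < l \<Longrightarrow> Psi_comp l m T = T"
  by (simp add: Psi_comp_def)

lemma Psi_comp_rec: "l \<le> m \<Longrightarrow> Psi_comp l m T = Psi l (Psi_comp (Suc l) m T)"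
  by (simp add: Psi_comp_def upt_conv_Cons del: upt_Suc)

lemma Psi_comp_SYT:
  assumes T: "T \<in> SYT lam" and "1 \<le> l"
  shows "Psi_comp l N T \<in> SYT lam"
proof (cases "l \<le> Suc N")
  case True
  then show ?thesis
    using assms(2)
  proof (induction l rule: inc_induct)
    case base
    then show ?case using T by (simp add: Psi_comp_empty)
  next
    case (step l)
    then show ?case
      using Psi_in_SYT[of "Psi_comp (Suc l) N T" l] by (simp add: Psi_comp_rec)
  qed
next
  case False
  then show ?thesis using T by (simp add: Psi_comp_empty)
qed

lemma Psi_trivial:
  assumes T: "T \<in> SYT lam" and "1 \<le> N" "k \<le> 2"
  shows "Psi k T = T"
proof
  fix c
  have "block_rot (near T k) k 1 = 1" if "1 < k"
    using block_rot_range[of "near T k" 1 k] near_1[OF T assms(2)] that assms by auto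
  moreover have "T c = 1" if "1 \<le> T c" "T c < k"
    using that assms by simp
  ultimately show "Psi k T c = T c"
    using Psi_eq[OF T assms(2), of k c] by auto
qed

text \<open>\<open>Psi 1\<close> and \<open>Psi 2\<close> are identities; including them lets the
  stages be indexed by all contents from 1.\<close>

lemma Psi_comp_3:
  assumes T: "T \<in> SYT lam"
  shows "Psi_comp 3 N T = Psi_comp 1 N T"
proof -
  have 2: "Psi_comp 2 N T = Psi_comp 3 N T"
  proof (cases "2 \<le> N")
    case True
    then show ?thesis
      using Psi_comp_rec[of 2 N T] Psi_trivial[OF Psi_comp_SYT[OF T], of 3 2] by simp
  qed (simp add: Psi_comp_empty)
  have 1: "Psi_comp 1 N T = Psi_comp 2 N T"
  proof (cases "1 \<le> N")
    case True
    then show ?thesis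
      using Psi_comp_rec[of 1 N T] Psi_trivial[OF Psi_comp_SYT[OF T], of 2 1]
      by (simp add: numeral_2_eq_2)
  next
    case False
    then have "N < 1" "N < 2" by linarith+
    then show ?thesis by (simp only: Psi_comp_empty)
  qed
  show ?thesis using 1 2 by simp
qed

text \<open>The maps \<open>Psi l\<close> with \<open>l \<le> k\<close> move only contents below
  \<open>k\<close>.\<close>

lemma cell_of_Psi_comp:
  assumes T: "T \<in> SYT lam" and k: "1 \<le> k" "k \<le> N" and "1 \<le> l" "l \<le> Suc k"
  shows "cell_of (Psi_comp l N T) k = cell_of (Psi_comp (Suc k) N T) k"
  using assms(5,4)
proof (induction l rule: inc_induct)
  case base
  then show ?case by simp
next
  case (step l)
  then show ?case
    using cell_of_Psi[OF Psi_comp_SYT[OF T], of "Suc l" l k] k by (simp add: Psi_comp_rec)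
qed

text \<open>The cell of \<open>k\<close> at stage \<open>k + 1\<close> is already its final cell, so
  the index of a cell is its final content.\<close>

lemma inv_index_eq:
  assumes T: "T \<in> SYT lam" and c: "c \<in> D"
  shows "inv_index N T c = Psi_comp 1 N T c"
  unfolding inv_index_def
proof (rule the_equality)
  define S where "S = Psi_comp 1 N T"
  have S: "S \<in> SYT lam" using Psi_comp_SYT[OF T] by (simp add: S_def)
  have cells: "cell_of (Psi_comp (k + 1) N T) k = cell_of S k" if "k \<in> {1..N}" for k
    using cell_of_Psi_comp[OF T, of k 1] that by (simp add: S_def)
  show "Psi_comp 1 N T c \<in> {1..N} \<and>
      cell_of (Psi_comp (Psi_comp 1 N T c + 1) N T) (Psi_comp 1 N T c) = c"
    using cells[of "S c"] SYT_range[OF S c] cell_of_content[OF S c] by (simp add: S_def)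
  fix k assume k: "k \<in> {1..N} \<and> cell_of (Psi_comp (k + 1) N T) k = c"
  then have "S (cell_of S k) = k"
    using cell_of_props(2)[OF S, of k] by simp
  then show "k = Psi_comp 1 N T c"
    using cells[of k] k by (simp add: S_def)
qed

lemma below_inv_path_eq:
  assumes T: "T \<in> SYT lam" and k: "1 \<le> k" "k \<le> N"
  shows "below_inv_path N T (cell_of (Psi_comp (Suc k) N T) k) d \<longleftrightarrow>
    below (Psi_comp (Suc k) N T) k d"
proof -
  define c where "c = cell_of (Psi_comp (Suc k) N T) k"
  have S: "Psi_comp 1 N T \<in> SYT lam" using Psi_comp_SYT[OF T] by simp
  have cS: "c = cell_of (Psi_comp 1 N T) k"
    using cell_of_Psi_comp[OF T k, of 1] by (simp add: c_def)
  then have "inv_index N T c = k"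
    using inv_index_eq[OF T, of c] cell_of_props[OF S k] by simp
  then show ?thesis
    by (simp add: below_inv_path_def c_def)
qed

text \<open>Every inversion path starts at its own cell; these two facts hold whatever course it
  takes from there.\<close>

lemma below_inv_path_position:
  assumes T: "T \<in> SYT lam" and c: "(i, j) \<in> D" and d: "(i', j') \<in> D"
  shows "below_inv_path N T (i, j) (i', j') \<Longrightarrow> i' < i"
    "i' < i \<Longrightarrow> j \<le> j' \<Longrightarrow> below_inv_path N T (i, j) (i', j')"
proof -
  define S where "S = Psi_comp 1 N T"
  define k where "k = S (i, j)"
  have S: "S \<in> SYT lam" using Psi_comp_SYT[OF T] by (simp add: S_def)
  have k: "1 \<le> k" "k \<le> N" using SYT_range[OF S c] by (auto simp: k_def)
  have cell: "cell_of (Psi_comp (Suc k) N T) k = (i, j)"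
    using cell_of_Psi_comp[OF T k, of 1] cell_of_content[OF S c] by (simp add: S_def k_def)
  note eq = below_inv_path_eq[OF T k, of "(i', j')", unfolded cell]
  show "below_inv_path N T (i, j) (i', j') \<Longrightarrow> i' < i"
    using eq below_row[OF cell] by blast
  show "i' < i \<Longrightarrow> j \<le> j' \<Longrightarrow> below_inv_path N T (i, j) (i', j')"
    using eq below_right[OF cell, of i' j'] c d by (auto simp: diagram_def)
qed

text \<open>The first cell holds a block start, the second an inner element of the same
  block.\<close>

definition reversed :: "nat \<Rightarrow> filling \<Rightarrow> (cell \<times> cell) set" where
  "reversed k T = {(x, y). x \<in> D \<and> y \<in> D \<and> T x < k \<and> T y < k \<and> T x < T y \<and> Psi k T y < Psi k T x}"

lemma reversed_sides:
  assumes T: "T \<in> SYT lam" and xy: "(x, y) \<in> reversed k T"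
  shows "near_cell T k x" "\<not> near_cell T k y"
    "\<And>e. e \<in> D \<Longrightarrow> T x < T e \<Longrightarrow> T e \<le> T y \<Longrightarrow> \<not> near_cell T k e"
proof -
  have "x \<in> D" "y \<in> D" "T x < T y" "\<not> Psi k T x < Psi k T y"
    using xy by (auto simp: reversed_def)
  then have "near T k (T x) \<and> \<not> (\<exists>e\<in>D. T x < T e \<and> T e \<le> T y \<and> near T k (T e))"
    using Psi_preserves[OF T] by blast
  then show "near_cell T k x" "\<not> near_cell T k y"
    "\<And>e. e \<in> D \<Longrightarrow> T x < T e \<Longrightarrow> T e \<le> T y \<Longrightarrow> \<not> near_cell T k e"
    using \<open>x \<in> D\<close> \<open>y \<in> D\<close> \<open>T x < T y\<close> by (auto simp: near_content[OF T] near_cell_def)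
qed

text \<open>Each inner cell is passed by the start of its own block and by no other cell, so the
  second projection is bijective.\<close>

lemma card_reversed:
  assumes T: "T \<in> SYT lam" and k: "1 \<le> k" "k \<le> N"
  shows "card (reversed k T) = card {y \<in> D. T y < k \<and> \<not> near_cell T k y}"
proof -
  have nr: "near T k (T x) \<longleftrightarrow> near_cell T k x" if "x \<in> D" for x
    using that by (simp add: near_content[OF T] near_cell_def)
  have inj: "inj_on snd (reversed k T)"
  proof (rule inj_onI)
    \<comment> \<open>Otherwise \<open>x'\<close> would be a start between \<open>x\<close> and
      \<open>y\<close>.\<close>
    have less: "\<not> T x < T x'" if "(x, y) \<in> reversed k T" "(x', y) \<in> reversed k T" for x x' y
      using reversed_sides(3)[OF T that(1), of x'] reversed_sides(1)[OF T that(2)] that(2)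
      by (auto simp: reversed_def)
    fix p q assume pq: "p \<in> reversed k T" "q \<in> reversed k T" "snd p = snd q"
    obtain x y where p: "p = (x, y)" by (cases p)
    obtain x' where q: "q = (x', y)" using pq(3) p by (cases q) simp
    have "T x = T x'"
      using less[of x y x'] less[of x' y x] pq p q by simp
    moreover have "x \<in> D" "x' \<in> D" using pq p q by (auto simp: reversed_def)
    ultimately show "p = q" using SYT_inj[OF T] p q by auto
  qed
  have "snd ` reversed k T = {y \<in> D. T y < k \<and> \<not> near_cell T k y}"
  proof (intro equalityI subsetI)
    fix y assume "y \<in> snd ` reversed k T"
    then obtain x where "(x, y) \<in> reversed k T" by force
    then show "y \<in> {y \<in> D. T y < k \<and> \<not> near_cell T k y}"
      using reversed_sides(2)[OF T, of x y k] by (simp add: reversed_def)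
  next
    fix y assume "y \<in> {y \<in> D. T y < k \<and> \<not> near_cell T k y}"
    then have y: "y \<in> D" "T y < k" "\<not> near T k (T y)" using nr by auto
    have y1: "1 \<le> T y" "1 \<le> N" using SYT_range[OF T y(1)] by auto
    obtain a where a: "1 \<le> a" "a \<le> T y" "near T k a"
      "\<And>v. a < v \<Longrightarrow> v \<le> T y \<Longrightarrow> \<not> near T k v"
      using block_start[of "near T k" "T y", OF near_1[OF T y1(2)] y1(1)] by blast
    define x where "x = cell_of T a"
    have x: "x \<in> D" "T x = a"
      using cell_of_props[OF T, of a] a y k by (auto simp: x_def)
    have less: "a < T y" using a y by (auto simp: le_less)
    have "Psi k T y < Psi k T x"
      using block_rot_reverses[where p = "near T k", OF less y(2) a(3,4)] x y less by (simp add: Psi_eq_rot[OF T])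
    then have "(x, y) \<in> reversed k T"
      using x y less by (simp add: reversed_def)
    then show "y \<in> snd ` reversed k T" by force
  qed
  then show ?thesis
    using card_image[OF inj] by simp
qed

text \<open>Both \<open>T\<close> and \<open>Psi k T\<close> are standard, so the two cells of a reversed pair are incomparable;
  the sides on which they lie then fix their relative position.\<close>

lemma reversed_position:
  assumes T: "T \<in> SYT lam" and k: "1 \<le> k" "k \<le> N" and xy: "((i, j), (i', j')) \<in> reversed k T"
  shows "if below T k (1, 1) then i < i' \<and> j' < j else i' < i \<and> j < j'"
proof -
  have cells: "(i, j) \<in> D" "(i', j') \<in> D" "T (i, j) < T (i', j')" "Psi k T (i', j') < Psi k T (i, j)"
    using xy by (auto simp: reversed_def)
  then have ge1: "1 \<le> i" "1 \<le> i'" by (auto simp: diagram_def)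
  have ne: "(i, j) \<noteq> (i', j')" using cells(3) by auto
  have T': "Psi k T \<in> SYT lam" using Psi_in_SYT[OF T k] .
  have 1: "\<not> (i \<le> i' \<and> j \<le> j')"
    using SYT_mono[OF T' cells(1,2)] cells(4) ne by auto
  have 2: "\<not> (i' \<le> i \<and> j' \<le> j)"
    using SYT_mono[OF T cells(2,1)] cells(3) ne by auto
  have sides: "below T k (i, j) = below T k (1, 1)" "below T k (i', j') \<noteq> below T k (1, 1)"
    using reversed_sides(1,2)[OF T xy] by (auto simp: near_cell_def)
  show ?thesis
  proof (cases "below T k (1, 1)")
    case True
    then have "\<not> (i' \<le> i \<and> j \<le> j')"
      using below_SE[of T k i j i' j'] sides ge1 by blast
    then show ?thesis using 1 2 True by auto
  next
    case False
    then have "\<not> (i \<le> i' \<and> j' \<le> j)"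
      using below_SE[of T k i' j' i j] sides ge1 by blast
    then show ?thesis using 1 2 False by auto
  qed
qed

text \<open>Contents are taken just before \<open>Psi k\<close> is applied, but the inversion paths
  remain those attached to \<open>T\<close>. For \<open>k = N\<close> these are the inversion pairs
  of \<open>T\<close>.\<close>

definition inversions_upto :: "filling \<Rightarrow> nat \<Rightarrow> (cell \<times> cell) set" where
  "inversions_upto T k = {(c, d). c \<in> D \<and> d \<in> D \<and> Psi_comp (Suc k) N T c \<le> k \<and>
     Psi_comp (Suc k) N T d < Psi_comp (Suc k) N T c \<and> below_inv_path N T c d}"

lemma card_inversions_step:
  assumes T: "T \<in> SYT lam" and k: "1 \<le> k" "k \<le> N"
  shows "card (inversions_upto T k) = card (inversions_upto T (k - 1))
     + (if below (Psi_comp (Suc k) N T) k (1, 1) then k - 1 else 0)"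
proof -
  define W where "W = Psi_comp (Suc k) N T"
  have W: "W \<in> SYT lam" using Psi_comp_SYT[OF T] by (simp add: W_def)
  have W': "Psi_comp k N T = Psi k W"
    using Psi_comp_rec[of k N T] k by (simp add: W_def)
  have PW: "Psi k W \<in> SYT lam" using Psi_in_SYT[OF W k] .
  define q where "q = cell_of W k"
  have q: "q \<in> D" "W q = k" using cell_of_props[OF W k] by (auto simp: q_def)
  define R where "R = below_inv_path N T"
  have Rq: "R q d \<longleftrightarrow> below W k d" for d
    using below_inv_path_eq[OF T k] by (simp add: R_def q_def W_def)
  define P where "P = {c \<in> D. W c < k}"
  \<comment> \<open>\<open>F\<close> and \<open>G\<close> collect the pairs among the contents below
    \<open>k\<close>, ordered by \<open>W\<close> and by \<open>Psi k W\<close>; \<open>B\<close>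
    collects the partners of the cell \<open>q\<close> of \<open>k\<close>.\<close>
  define F where "F = {(c, d). c \<in> P \<and> d \<in> P \<and> W d < W c \<and> R c d}"
  define G where "G = {(c, d). c \<in> P \<and> d \<in> P \<and> Psi k W d < Psi k W c \<and> R c d}"
  define B where "B = {d \<in> P. below W k d}"
  have finP: "finite P" using finite_diagram by (simp add: P_def)
  have "F \<subseteq> P \<times> P" "G \<subseteq> P \<times> P" by (auto simp: F_def G_def)
  then have finF: "finite F" "finite G"
    using finP by (simp_all add: finite_subset[OF _ finite_cartesian_product])
  have cardP: "card P = k - 1"
    using SYT_rank[OF W q(1)] q(2) by (simp add: P_def)
  have "inversions_upto T k = Pair q ` B \<union> F"
  proof -
    have *: "W c \<le> k \<longleftrightarrow> c = q \<or> W c < k" if "c \<in> D" for c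
      using SYT_inj[OF W that q(1)] q by auto
    have "(c, d) \<in> inversions_upto T k \<longleftrightarrow> (c, d) \<in> Pair q ` B \<union> F" for c d
    proof (cases "c = q")
      case True
      have "(q, d) \<in> inversions_upto T k \<longleftrightarrow> d \<in> B"
        using q Rq[of d] unfolding inversions_upto_def W_def[symmetric] R_def[symmetric]
        by (simp add: B_def P_def)
      moreover have "(q, d) \<notin> F" using q by (simp add: F_def P_def)
      ultimately show ?thesis using True by blast
    next
      case False
      have "(c, d) \<in> inversions_upto T k \<longleftrightarrow> c \<in> D \<and> d \<in> D \<and> W c < k \<and> W d < W c \<and> R c d"
        using *[of c] False unfolding inversions_upto_def W_def[symmetric] R_def[symmetric] by blast
      also have "\<dots> \<longleftrightarrow> (c, d) \<in> F"
        unfolding F_def P_def by simp linarith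
      finally show ?thesis using False by blast
    qed
    then show ?thesis by (intro subset_antisym subrelI) blast+
  qed
  moreover have "Pair q ` B \<inter> F = {}"
    using q by (auto simp: F_def P_def)
  moreover have "card (Pair q ` B) = card B"
    by (intro card_image inj_onI) auto
  ultimately have I: "card (inversions_upto T k) = card B + card F"
    using finP finF by (simp add: card_Un_disjoint B_def)
  have G: "inversions_upto T (k - 1) = G"
  proof -
    have "Psi k W c \<le> k - 1 \<longleftrightarrow> W c < k" if "c \<in> D" for c
      using Psi_content_less_iff[OF W that, of k] k by auto
    moreover have "W d < k" if "c \<in> D" "d \<in> D" "W c < k" "Psi k W d < Psi k W c" for c d
      using Psi_content_less_iff[OF W that(1), of k] Psi_content_less_iff[OF W that(2), of k] that(3,4)
      by linarith
    ultimately have "(c, d) \<in> inversions_upto T (k - 1) \<longleftrightarrow> (c, d) \<in> G" for c d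
      using k unfolding inversions_upto_def G_def P_def R_def[symmetric] by (simp add: W') blast
    then show ?thesis by (intro subset_antisym subrelI) blast+
  qed
  have flip: "Psi k W c < Psi k W d" if "c \<in> P" "d \<in> P" "W d < W c" "\<not> Psi k W d < Psi k W c" for c d
  proof -
    have "Psi k W c \<noteq> Psi k W d"
      using SYT_inj[OF PW, of c d] that(1-3) by (auto simp: P_def)
    then show ?thesis using that(4) by linarith
  qed
  have flip': "W c < W d" if "c \<in> P" "d \<in> P" "Psi k W d < Psi k W c" "\<not> W d < W c" for c d
  proof -
    have "W c \<noteq> W d"
      using SYT_inj[OF W, of c d] that(1-3) by (auto simp: P_def)
    then show ?thesis using that(4) by linarith
  qed
  have memF: "(c, d) \<in> F \<longleftrightarrow> c \<in> P \<and> d \<in> P \<and> W d < W c \<and> R c d" for c d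
    by (simp add: F_def)
  have memG: "(c, d) \<in> G \<longleftrightarrow> c \<in> P \<and> d \<in> P \<and> Psi k W d < Psi k W c \<and> R c d" for c d
    by (simp add: G_def)
  have rev: "(x, y) \<in> reversed k W \<longleftrightarrow> x \<in> P \<and> y \<in> P \<and> W x < W y \<and> Psi k W y < Psi k W x" for x y
    by (auto simp: reversed_def P_def)
  have cardrev: "card (reversed k W) = card {y \<in> P. \<not> near_cell W k y}"
    unfolding card_reversed[OF W k] by (rule arg_cong[of _ _ card]) (auto simp: P_def)
  show ?thesis
  proof (cases "below W k (1, 1)")
    case False
    \<comment> \<open>The start \<open>x\<close> is strictly northwest of \<open>y\<close>: so
      \<open>(y, x)\<close> never counts, and \<open>(x, y)\<close> counts only after
      \<open>Psi k\<close> has reversed the contents.\<close>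
    have Rxy: "R x y \<and> \<not> R y x" if xy: "(x, y) \<in> reversed k W" for x y
    proof -
      obtain i j i' j' where ij: "x = (i, j)" "y = (i', j')" by force
      have cells: "(i, j) \<in> D" "(i', j') \<in> D" using xy ij by (auto simp: reversed_def)
      have "i' < i" "j < j'" using reversed_position[OF W k] xy ij False by auto
      then show ?thesis
        unfolding R_def ij
        using below_inv_path_position[OF T cells] below_inv_path_position[OF T cells(2,1)]
        by (meson less_asym less_imp_le)
    qed
    have "(c, d) \<in> G" if "(c, d) \<in> F" for c d
      using that flip[of c d] Rxy[of d c] unfolding memF memG rev by blast
    then have "F \<subseteq> G" by (intro subrelI)
    moreover have "G - F = reversed k W"
    proof (intro subset_antisym subrelI)
      fix c d assume "(c, d) \<in> G - F"
      then show "(c, d) \<in> reversed k W"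
        using flip'[of c d] unfolding Diff_iff memF memG rev by blast
    next
      fix c d assume "(c, d) \<in> reversed k W"
      then show "(c, d) \<in> G - F"
        using Rxy[of c d] unfolding Diff_iff memF memG rev by auto
    qed
    ultimately have "card G = card F + card (reversed k W)"
      using card_Diff_subset[of F G] card_mono[of G F] finF by simp
    \<comment> \<open>The inner cells are those below the path, which are the partners of
      \<open>q\<close>; the gain in \<open>G\<close> cancels \<open>B\<close>.\<close>
    moreover have "card (reversed k W) = card B"
      unfolding cardrev B_def using False by (simp add: near_cell_def)
    ultimately show ?thesis
      using I G False by (simp add: W_def)
  next
    case True
    \<comment> \<open>Now \<open>x\<close> is strictly southeast of \<open>y\<close>, and
      \<open>(y, x)\<close> counts only before \<open>Psi k\<close>.\<close>
    have Rxy: "R y x \<and> \<not> R x y" if xy: "(x, y) \<in> reversed k W" for x y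
    proof -
      obtain i j i' j' where ij: "x = (i, j)" "y = (i', j')" by force
      have cells: "(i, j) \<in> D" "(i', j') \<in> D" using xy ij by (auto simp: reversed_def)
      have "i < i'" "j' < j" using reversed_position[OF W k] xy ij True by auto
      then show ?thesis
        unfolding R_def ij
        using below_inv_path_position[OF T cells] below_inv_path_position[OF T cells(2,1)]
        by (meson less_asym less_imp_le)
    qed
    have "(c, d) \<in> F" if "(c, d) \<in> G" for c d
      using that flip'[of c d] Rxy[of c d] unfolding memF memG rev by blast
    then have "G \<subseteq> F" by (intro subrelI)
    moreover have "F - G = (reversed k W)\<inverse>"
    proof (intro subset_antisym subrelI)
      fix c d assume "(c, d) \<in> F - G"
      then show "(c, d) \<in> (reversed k W)\<inverse>"
        using flip[of c d] unfolding Diff_iff converse_iff memF memG rev by blast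
    next
      fix c d assume "(c, d) \<in> (reversed k W)\<inverse>"
      then show "(c, d) \<in> F - G"
        using Rxy[of d c] unfolding Diff_iff converse_iff memF memG rev by auto
    qed
    ultimately have "card F = card G + card (reversed k W)"
      using card_Diff_subset[of G F] card_mono[of F G] finF by simp
    \<comment> \<open>\<open>B\<close> counts the cells below the path, the reversed pairs those
      above it: \<open>k - 1\<close> in total.\<close>
    moreover have "card B + card (reversed k W) = card P"
    proof -
      have "{y \<in> P. \<not> near_cell W k y} = P - B"
        using True by (auto simp: B_def near_cell_def)
      moreover have "B \<subseteq> P" by (auto simp: B_def)
      ultimately show ?thesis
        unfolding cardrev
        using card_Diff_subset[of B P] card_mono[of P B] finP finite_subset[of B P] by simp
    qed
    ultimately show ?thesis
      using I G True cardP by (simp add: W_def)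
  qed
qed

lemma Des_Suc:
  "Des (Suc m) S = (if 1 \<le> m \<and> fst (cell_of S m) < fst (cell_of S (m + 1))
     then insert m (Des m S) else Des m S)"
  by (auto simp: Des_def less_Suc_eq)

text \<open>Each stage adds \<open>k - 1\<close> exactly if the origin cell is below the path, which
  by \<open>Psi_side\<close> makes \<open>k - 1\<close> a descent.\<close>

lemma card_inversions_upto:
  assumes T: "T \<in> SYT lam"
  shows "k \<le> N \<Longrightarrow> card (inversions_upto T k) = maj k (Psi_comp 1 N T)"
proof (induction k)
  case 0
  have "inversions_upto T 0 = {}" by (auto simp: inversions_upto_def)
  then show ?case by (simp add: maj_def Des_def)
next
  case (Suc m)
  define S where "S = Psi_comp 1 N T"
  have fin: "finite (Des m S)"
    by (rule finite_subset[of _ "{..m}"]) (auto simp: Des_def)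
  have notin: "m \<notin> Des m S" by (simp add: Des_def)
  have IH: "card (inversions_upto T m) = \<Sum> (Des m S)"
    using Suc by (simp add: maj_def S_def)
  have step: "card (inversions_upto T (Suc m)) = card (inversions_upto T m)
     + (if below (Psi_comp (Suc (Suc m)) N T) (Suc m) (1, 1) then m else 0)"
    using card_inversions_step[OF T, of "Suc m"] Suc.prems by simp
  show ?case
  proof (cases "1 \<le> m")
    \<comment> \<open>For \<open>m = 0\<close> the increment is 0 on either side of the path, and 0
      is no descent.\<close>
    case False
    then show ?thesis
      unfolding S_def[symmetric] using step IH by (simp add: maj_def Des_Suc)
  next
    case True
    have "below (Psi_comp (Suc (Suc m)) N T) (Suc m) (1, 1) \<longleftrightarrow>
        fst (cell_of (Psi_comp (Suc m) N T) m) < fst (cell_of (Psi_comp (Suc (Suc m)) N T) (Suc m))"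
      using Psi_side[OF Psi_comp_SYT[OF T], of "Suc (Suc m)" "Suc m"] True Suc.prems
        Psi_comp_rec[of "Suc m" N T] by simp
    \<comment> \<open>The later maps leave the cells of \<open>m\<close> and \<open>m + 1\<close> in
      place, so the descent is one of \<open>S\<close>.\<close>
    then have "below (Psi_comp (Suc (Suc m)) N T) (Suc m) (1, 1) \<longleftrightarrow>
        fst (cell_of S m) < fst (cell_of S (m + 1))"
      using cell_of_Psi_comp[OF T, of m 1] cell_of_Psi_comp[OF T, of "Suc m" 1] True Suc.prems
      by (simp add: S_def)
    then show ?thesis
      unfolding S_def[symmetric] using step IH True fin notin by (simp add: maj_def Des_Suc)
  qed
qed

lemma Inv_eq:
  assumes T: "T \<in> SYT lam"
  shows "Inv lam T = card (inversions_upto T N)"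
proof -
  \<comment> \<open>The cell \<open>(1, 1)\<close> has content 1 and exceeds no other cell.\<close>
  have origin: "c \<noteq> (1, 1)" if "c \<in> D" "d \<in> D" "T d < T c" for c d
    using origin_content[OF T] SYT_range[OF T that(1)] SYT_range[OF T that(2)] that(3) by force
  have comp: "Psi_comp (Suc N) N T = T" by (simp add: Psi_comp_empty)
  have "(c, d) \<in> inversion_pairs lam T \<longleftrightarrow> (c, d) \<in> inversions_upto T N" for c d
    using origin[of c d] SYT_range[OF T, of c]
    unfolding inversion_pairs_def inversions_upto_def comp mem_Collect_eq prod.case by blast
  then have "inversion_pairs lam T = inversions_upto T N"
    by (intro subset_antisym subrelI) blast+
  then show ?thesis by (simp add: Inv_def)
qed

lemma Inv_eq_maj: "T \<in> SYT lam \<Longrightarrow> Inv lam T = maj N (Psi_comp 3 N T)"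
  using Inv_eq card_inversions_upto Psi_comp_3 by simp

section \<open>Bijectivity\<close>

lemma finite_SYT: "finite (SYT lam)"
proof (rule finite_subset)
  show "SYT lam \<subseteq> {T. \<forall>c. (c \<in> D \<longrightarrow> T c \<in> {..N}) \<and> (c \<notin> D \<longrightarrow> T c = 0)}"
    using SYT_range SYT_outside by blast
  show "finite {T. \<forall>c. (c \<in> D \<longrightarrow> T c \<in> {..N}) \<and> (c \<notin> D \<longrightarrow> T c = 0)}"
    by (rule finite_set_of_finite_funs[OF finite_diagram]) simp
qed

lemma inj_on_Psi_comp:
  assumes "2 \<le> l"
  shows "inj_on (Psi_comp l N) (SYT lam)"
proof (cases "l \<le> Suc N")
  case True
  then show ?thesis
    using assms
  proof (induction l rule: inc_induct)
    case base
    then show ?case by (simp add: inj_on_def Psi_comp_empty)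
  next
    case (step l)
    have "Psi_comp (Suc l) N ` SYT lam \<subseteq> SYT lam"
      using Psi_comp_SYT by auto
    then have "inj_on (Psi l \<circ> Psi_comp (Suc l) N) (SYT lam)"
      using step by (intro comp_inj_on inj_on_subset[OF inj_on_Psi[of l]]) auto
    moreover have "Psi l \<circ> Psi_comp (Suc l) N = Psi_comp l N"
      using step Psi_comp_rec[of l N] by auto
    ultimately show ?case by simp
  qed
next
  case False
  then show ?thesis by (simp add: inj_on_def Psi_comp_empty)
qed

text \<open>On a finite set an injective self-map is onto.\<close>

lemma bij_betw_Psi_comp: "bij_betw (Psi_comp 3 N) (SYT lam) (SYT lam)"
proof -
  have "Psi_comp 3 N ` SYT lam \<subseteq> SYT lam"
    using Psi_comp_SYT by auto
  then show ?thesis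
    using endo_inj_surj[OF finite_SYT] inj_on_Psi_comp[of 3] by (simp add: bij_betw_def)
qed

end

theorem theorem2:
  fixes lam :: "nat list" and n :: nat
  assumes "is_partition lam n"
  shows "bij_betw (Psi_comp 3 n) (SYT lam) (SYT lam)
       \<and> (\<forall>T \<in> SYT lam. Inv lam T = maj n (Psi_comp 3 n T))"
proof -
  interpret young_shape lam
    using assms by unfold_locales (simp add: is_partition_def)
  have "N = n" using assms by (simp add: is_partition_def)
  then show ?thesis
    using bij_betw_Psi_comp Inv_eq_maj by blast
qed

end
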